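(* The following properties are equivalent for each polytope $M$: (a) $M$ is a simple polytope. (b) $M$ is cube-like.
   Context: A polytope $M$ in a finite-dimensional real vector space $E$ is the convex hull of a non-empty finite subset; $\operatorname{aff}(M)$ is its affine hull; $M$ is an $n$-polytope if $\dim\operatorname{aff}(M)=n$. A face of $M$ is a convex subset $F\subseteq M$ such that $x,y\in M$, $t\in\,]0,1[$ and $tx+(1-t)y\in F$ imply $x,y\in F$. Faces of dimension $0$, $1$, $n-1$ are called vertices, edges, facets. An $n$-polytope $M$ is simple if the following equivalent conditions hold: each vertex is contained in exactly $n$ edges; each vertex is contained in exactly $n$ facets; for each $k\in\{0,\dots,n-1\}$, each $k$-dimensional face is contained in exactly $n-k$ facets. If $U$ is a relatively open subset of a convex set with non-empty interior in $\mathbb R^n$, a map $U\to\mathbb R^d$ is smooth if it is continuous, smooth on the interior $\mathring U$ and all iterated directional derivatives extend to continuous maps $U\times(\mathbb R^n)^k\to\mathbb R^d$. A $C^\infty$-diffeomorphism $\phi\colon U\to V$ between a relatively open subset $U$ of an $n$-polytope $M\subseteq\mathbb R^n$ and a relatively open subset $V\subseteq[0,\infty[^n$ is a smooth bijection with smooth inverse. An $n$-polytope $M\subseteq\mathbb R^n$ is cube-like if $M$ is covered by the domains $U$ of $C^\infty$-diffeomorphisms $\phi\colon U\to V$ from relatively open subsets $U\subseteq M$ onto relatively open subsets $V\subseteq[0,\infty[^n$ (where $[0,\infty[^0:=\{0\}$). An $n$-polytope $P$ in a finite-dimensional vector space $E$ is cube-like if there is an injective affine map $f\colon\mathbb R^n\to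 E$ with $f(\mathbb R^n)=\operatorname{aff}(P)$ such that $f^{-1}(P)$ is a cube-like $n$-polytope in $\mathbb R^n$. *)

theory Defs
  imports "HOL-Analysis.Analysis" "HOL-Analysis.Finite_Function_Topology"
begin

text \<open>
  The dimension \<open>n\<close> is determined by the polytope and may be \<open>0\<close>, so \<open>\<real>\<^sup>n\<close> cannot be a type
  \<open>real ^ 'n\<close>. It is the subspace of finitely supported sequences supported in \<open>{..<n}\<close>.
  The norm of \<open>nat \<Rightarrow>\<^sub>0 real\<close> is the \<open>\<ell>\<^sup>1\<close> norm, which induces the usual topology on \<open>\<real>\<^sup>n\<close>.
\<close>

type_synonym rvec = "nat \<Rightarrow>\<^sub>0 real"

definition Rn :: "nat \<Rightarrow> rvec set" where
  "Rn n = {x. Poly_Mapping.keys x \<subseteq> {..<n}}"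

definition orthant :: "nat \<Rightarrow> rvec set" where
  "orthant n = {x \<in> Rn n. \<forall>i<n. 0 \<le> Poly_Mapping.lookup x i}"

text \<open>The iterated directional derivative of \<open>f\<close> at \<open>x\<close>, first in direction \<open>v 0\<close> and last in
  direction \<open>v (k - 1)\<close>. Only \<open>v 0, \<dots>, v (k - 1)\<close> matter, and only the values of \<open>f\<close> near \<open>x\<close>
  in the span of these directions. Meaningful only where the derivatives exist.\<close>

primrec iter_dir_deriv ::
    "nat \<Rightarrow> ('a::real_normed_vector \<Rightarrow> 'b::real_normed_vector) \<Rightarrow> (nat \<Rightarrow> 'a) \<Rightarrow> 'a \<Rightarrow> 'b" where
  "iter_dir_deriv 0 f v x = f x"
| "iter_dir_deriv (Suc k) f v x =
     vector_derivative (\<lambda>t. iter_dir_deriv k f v (x + t *\<^sub>R v k)) (at 0)"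

text \<open>Smoothness on an open subset of \<open>\<real>\<^sup>n\<close>: all iterated directional derivatives exist and are
  continuous on \<open>\<Omega> \<times> (\<real>\<^sup>n)\<^sup>k\<close>. Here \<open>(\<real>\<^sup>n)\<^sup>k\<close> is \<open>{..<k} \<rightarrow>\<^sub>E Rn n\<close>, with the
  subspace topology of the product topology on \<open>nat \<Rightarrow> rvec\<close>.\<close>

definition smooth_on_open :: "nat \<Rightarrow> rvec set \<Rightarrow> (rvec \<Rightarrow> rvec) \<Rightarrow> bool" where
  "smooth_on_open n \<Omega> f \<longleftrightarrow>
     (\<forall>k. \<forall>x\<in>\<Omega>. \<forall>v \<in> {..<Suc k} \<rightarrow>\<^sub>E Rn n.
        (\<lambda>t. iter_dir_deriv k f v (x + t *\<^sub>R v k)) differentiable (at 0)) \<and>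
     (\<forall>k. continuous_on (\<Omega> \<times> ({..<k} \<rightarrow>\<^sub>E Rn n)) (\<lambda>(x, v). iter_dir_deriv k f v x))"

text \<open>Smoothness of \<open>f : U \<rightarrow> \<real>\<^sup>d\<close> for \<open>U\<close> a relatively open subset of a convex subset of \<open>\<real>\<^sup>n\<close>
  with non-empty interior. The interior of \<open>U\<close> is the one in \<open>\<real>\<^sup>n\<close>, not in the type \<open>rvec\<close>.\<close>

definition smooth_map :: "nat \<Rightarrow> nat \<Rightarrow> rvec set \<Rightarrow> (rvec \<Rightarrow> rvec) \<Rightarrow> bool" where
  "smooth_map n d U f \<longleftrightarrow>
     f \<in> U \<rightarrow> Rn d \<and>
     continuous_on U f \<and>
     smooth_on_open n (top_of_set (Rn n) interior_of U) f \<and>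
     (\<forall>k. \<exists>g. g \<in> U \<times> ({..<k} \<rightarrow>\<^sub>E Rn n) \<rightarrow> Rn d \<and>
        continuous_on (U \<times> ({..<k} \<rightarrow>\<^sub>E Rn n)) g \<and>
        (\<forall>x \<in> top_of_set (Rn n) interior_of U. \<forall>v \<in> {..<k} \<rightarrow>\<^sub>E Rn n.
           g (x, v) = iter_dir_deriv k f v x))"

definition smooth_diffeo :: "nat \<Rightarrow> rvec set \<Rightarrow> rvec set \<Rightarrow> (rvec \<Rightarrow> rvec) \<Rightarrow> bool" where
  "smooth_diffeo n U V \<phi> \<longleftrightarrow>
     bij_betw \<phi> U V \<and> smooth_map n n U \<phi> \<and> smooth_map n n V (inv_into U \<phi>)"

text \<open>\<open>aff_dim\<close> requires a Euclidean space type; here the dimension of the affine hull is expressed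
  as the dimension of its direction space.\<close>

definition full_polytope :: "nat \<Rightarrow> rvec set \<Rightarrow> bool" where
  "full_polytope n Q \<longleftrightarrow>
     polytope Q \<and> Q \<noteq> {} \<and> Q \<subseteq> Rn n \<and>
     dim {x - y |x y. x \<in> affine hull Q \<and> y \<in> affine hull Q} = n"

definition cube_like_Rn :: "nat \<Rightarrow> rvec set \<Rightarrow> bool" where
  "cube_like_Rn n Q \<longleftrightarrow>
     full_polytope n Q \<and>
     (\<forall>x\<in>Q. \<exists>U V \<phi>. x \<in> U \<and> openin (top_of_set Q) U \<and> openin (top_of_set (orthant n)) V \<and>
        smooth_diffeo n U V \<phi>)"

definition affine_map_on :: "'a::real_vector set \<Rightarrow> ('a \<Rightarrow> 'b::real_vector) \<Rightarrow> bool" where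
  "affine_map_on S f \<longleftrightarrow>
     (\<forall>x\<in>S. \<forall>y\<in>S. \<forall>t. f ((1 - t) *\<^sub>R x + t *\<^sub>R y) = (1 - t) *\<^sub>R f x + t *\<^sub>R f y)"

definition cube_like :: "'a::euclidean_space set \<Rightarrow> bool" where
  "cube_like P \<longleftrightarrow>
     polytope P \<and> P \<noteq> {} \<and>
     (\<exists>n f. aff_dim P = int n \<and>
        affine_map_on (Rn n) f \<and> inj_on f (Rn n) \<and> f ` Rn n = affine hull P \<and>
        cube_like_Rn n {x \<in> Rn n. f x \<in> P})"

text \<open>Of the three standard equivalent conditions (\<open>n\<close> edges at each vertex, \<open>n\<close> facets at each
  vertex, \<open>n - k\<close> facets through each \<open>k\<close>-face) the second one is taken as the definition.\<close>

definition simple_polytope :: "'a::euclidean_space set \<Rightarrow> bool" where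
  "simple_polytope P \<longleftrightarrow>
     polytope P \<and> P \<noteq> {} \<and>
     (\<forall>v. {v} face_of P \<longrightarrow> int (card {F. F facet_of P \<and> v \<in> F}) = aff_dim P)"

end

theory Submission
  imports Defs
begin

text \<open>
  At a vertex \<open>m\<close> of a simple \<open>n\<close>-polytope the normals of the \<open>n\<close> facets through \<open>m\<close> are linearly
  independent on the direction space, since a common zero direction would contradict that \<open>m\<close> is
  extreme. So the slacks of these facets form an affine chart of the part of the polytope that
  avoids the other facets. These parts cover: any point lies in a minimal face, and a vertex of
  that face lies on every facet through the point.

  Conversely, a chart around a vertex is differentiable there relative to the polytope, because its
  directional derivatives extend continuously to the boundary. Its derivative and that of its
  inverse restrict to mutually inverse bijections between the tangent cone of the polytope and that
  of the orthant at the image point. The former contains no line, so the image point is the origin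
  and the tangent cone is generated by a basis. A polytope with such a cone at \<open>m\<close> has exactly \<open>n\<close>
  facets through \<open>m\<close>.
\<close>

section \<open>Coordinate space\<close>

text \<open>The definition of smoothness supplies no total derivative, only directional derivatives
  at interior points and continuous extensions of them to the rest of the domain. A vertex is never
  interior when n > 0, so the derivative there has to be built: at interior points, continuity of
  the directional derivatives in the point makes them linear in the direction, and the resulting
  approximation is carried to the boundary by continuity. At a boundary point a derivative can then
  be tested along one-sided segments inside the set, which is why the inverse relations between the
  two derivatives are first obtained on tangent cones only. The polytope, pulled back to
  \<open>Rn n\<close> with its facet slacks, and the orthant are two instances of one locale, so
  every fact about a chart also serves its inverse. In the other direction all charts are affine, so
  smoothness is a matter of explicit formulas and the work lies in the description of a polytope by
  its facet inequalities and in linear algebra at a vertex.\<close>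

lemma lookup_scaleR [simp]:
  "Poly_Mapping.lookup (r *\<^sub>R x) i = r *\<^sub>R Poly_Mapping.lookup (x::'i \<Rightarrow>\<^sub>0 'b::real_vector) i"
proof -
  have "finite {i. r *\<^sub>R Poly_Mapping.lookup x i \<noteq> 0}"
    by (rule finite_subset[OF _ finite_keys[of x]]) (auto simp: in_keys_iff)
  then show ?thesis
    by (simp add: scaleR_poly_mapping_def)
qed

lemma abs_lookup_le_norm: "\<bar>Poly_Mapping.lookup (x::rvec) i\<bar> \<le> norm x"
proof (cases "i \<in> Poly_Mapping.keys x")
  case True
  have "\<bar>Poly_Mapping.lookup x i\<bar> \<le> (\<Sum>j\<in>Poly_Mapping.keys x. \<bar>Poly_Mapping.lookup x j\<bar>)"
    by (rule member_le_sum[OF True]) auto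
  then show ?thesis
    by (simp add: norm_poly_mapping_def dist_poly_mapping_def)
next
  case False
  then show ?thesis by (simp add: in_keys_iff)
qed

lemma bounded_linear_lookup [bounded_linear]: "bounded_linear (\<lambda>x::rvec. Poly_Mapping.lookup x i)"
  by (rule bounded_linear_intro[where K = 1])
    (auto simp: lookup_add abs_lookup_le_norm)

lemma norm_Rn:
  assumes "x \<in> Rn n"
  shows "norm x = (\<Sum>i<n. \<bar>Poly_Mapping.lookup x i\<bar>)"
proof -
  have "norm x = (\<Sum>i\<in>Poly_Mapping.keys x. \<bar>Poly_Mapping.lookup x i\<bar>)"
    by (simp add: norm_poly_mapping_def dist_poly_mapping_def)
  also have "\<dots> = (\<Sum>i<n. \<bar>Poly_Mapping.lookup x i\<bar>)"
    using assms by (intro sum.mono_neutral_left) (auto simp: Rn_def in_keys_iff)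
  finally show ?thesis .
qed

lemma Rn_iff: "x \<in> Rn n \<longleftrightarrow> (\<forall>i\<ge>n. Poly_Mapping.lookup x i = 0)"
proof
  assume "x \<in> Rn n"
  then show "\<forall>i\<ge>n. Poly_Mapping.lookup x i = 0"
    by (auto simp: Rn_def simp flip: not_in_keys_iff_lookup_eq_zero)
next
  assume "\<forall>i\<ge>n. Poly_Mapping.lookup x i = 0"
  then show "x \<in> Rn n"
    by (auto simp: Rn_def in_keys_iff) (meson not_le)
qed

lemma subspace_Rn: "subspace (Rn n)"
  by (auto simp: subspace_def Rn_iff lookup_add)

lemmas Rn_closed = subspace_0[OF subspace_Rn] subspace_add[OF subspace_Rn]
  subspace_diff[OF subspace_Rn] subspace_scale[OF subspace_Rn] subspace_neg[OF subspace_Rn]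

lemma Rn_eqI:
  assumes "x \<in> Rn n" "y \<in> Rn n" "\<And>i. i < n \<Longrightarrow> Poly_Mapping.lookup x i = Poly_Mapping.lookup y i"
  shows "x = y"
  using assms by (intro poly_mapping_eqI) (metis Rn_iff not_le)

definition rvec_of :: "nat \<Rightarrow> (nat \<Rightarrow> real) \<Rightarrow> rvec" where
  "rvec_of n t = (\<Sum>i<n. t i *\<^sub>R Poly_Mapping.single i 1)"

text \<open>The linear map with columns \<open>c 0\<close>, ..., \<open>c (n - 1)\<close>.
  Coordinates from \<open>n\<close> on are ignored, so it is bounded linear on the whole type and
  not merely on \<open>Rn n\<close>.\<close>

definition lincomb :: "nat \<Rightarrow> (nat \<Rightarrow> 'b::real_normed_vector) \<Rightarrow> rvec \<Rightarrow> 'b" where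
  "lincomb n c y = (\<Sum>i<n. Poly_Mapping.lookup y i *\<^sub>R c i)"

lemma lookup_sum_scaleR_single:
  "finite A \<Longrightarrow> Poly_Mapping.lookup (\<Sum>i\<in>A. t i *\<^sub>R Poly_Mapping.single i (1::real)) j = (if j \<in> A then t j else 0)"
  by (induction A rule: finite_induct) (auto simp: lookup_add lookup_single when_def)

lemma lookup_rvec_of: "Poly_Mapping.lookup (rvec_of n t) i = (if i < n then t i else 0)"
  by (simp add: rvec_of_def lookup_sum_scaleR_single)

lemma rvec_of_in_Rn [simp]: "rvec_of n t \<in> Rn n"
  by (simp add: Rn_iff lookup_rvec_of)

lemma rvec_of_lookup: "x \<in> Rn n \<Longrightarrow> rvec_of n (Poly_Mapping.lookup x) = x"
  by (rule Rn_eqI[of _ n]) (auto simp: lookup_rvec_of)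

lemma single_in_Rn: "i < n \<Longrightarrow> Poly_Mapping.single i (1::real) \<in> Rn n"
  by (simp add: Rn_def)

lemma bounded_linear_lincomb: "bounded_linear (lincomb n c)"
  unfolding lincomb_def
  by (intro bounded_linear_sum bounded_linear_scaleR_const bounded_linear_lookup)

lemma bounded_linear_rvec_of:
  "(\<And>i. i < n \<Longrightarrow> bounded_linear (\<lambda>x. t x i)) \<Longrightarrow> bounded_linear (\<lambda>x. rvec_of n (t x))"
  unfolding rvec_of_def
  by (intro bounded_linear_sum bounded_linear_scaleR_const) auto

lemma lincomb_rvec_of: "lincomb n c (rvec_of n t) = (\<Sum>i<n. t i *\<^sub>R c i)"
  by (simp add: lincomb_def lookup_rvec_of)

lemma linear_eq_lincomb:
  assumes "linear L" "y \<in> Rn n"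
  shows "L y = lincomb n (\<lambda>i. L (Poly_Mapping.single i 1)) y"
proof -
  have "L y = L (rvec_of n (Poly_Mapping.lookup y))"
    by (simp add: rvec_of_lookup assms)
  then show ?thesis
    unfolding rvec_of_def lincomb_def by (simp add: linear_sum[OF assms(1)] linear_scale[OF assms(1)])
qed

lemma lincomb_in_Rn: "(\<And>i. i < n \<Longrightarrow> c i \<in> Rn m) \<Longrightarrow> lincomb n c y \<in> Rn m"
  unfolding lincomb_def by (rule subspace_sum[OF subspace_Rn]) (simp add: Rn_closed)

lemma dim_Rn: "dim (Rn n) = n"
proof -
  let ?e = "\<lambda>i. Poly_Mapping.single i (1::real)"
  have inj: "inj_on ?e {..<n}"
    by (rule inj_onI) (metis keys_single singleton_inject zero_neq_one)
  have span: "span (?e ` {..<n}) = Rn n"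
  proof (rule span_subspace[OF _ _ subspace_Rn])
    show "?e ` {..<n} \<subseteq> Rn n" by (auto simp: single_in_Rn)
    show "Rn n \<subseteq> span (?e ` {..<n})"
    proof
      fix x assume "x \<in> Rn n"
      then have "x = (\<Sum>i<n. Poly_Mapping.lookup x i *\<^sub>R ?e i)"
        by (metis rvec_of_def rvec_of_lookup)
      also have "\<dots> \<in> span (?e ` {..<n})"
        by (intro span_sum span_scale span_base) auto
      finally show "x \<in> span (?e ` {..<n})" .
    qed
  qed
  have "independent (?e ` {..<n})"
  proof (rule independent_if_scalars_zero)
    show "finite (?e ` {..<n})" by simp
    fix f x assume 0: "(\<Sum>x\<in>?e ` {..<n}. f x *\<^sub>R x) = 0" and x: "x \<in> ?e ` {..<n}"
    then obtain j where j: "j < n" "x = ?e j" by auto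
    have "(\<Sum>i<n. f (?e i) *\<^sub>R ?e i) = 0"
      using 0 by (simp add: sum.reindex[OF inj])
    then have "Poly_Mapping.lookup (\<Sum>i<n. f (?e i) *\<^sub>R ?e i) j = 0" by simp
    then show "f x = 0"
      using j by (simp add: lookup_sum_scaleR_single)
  qed
  then have "dim (Rn n) = card (?e ` {..<n})"
    by (intro dim_eq_card) (simp add: span span_eq_iff[THEN iffD2, OF subspace_Rn])
  then show ?thesis by (simp add: card_image[OF inj])
qed

section \<open>Smoothness of affine maps\<close>

abbreviation interior_Rn :: "nat \<Rightarrow> rvec set \<Rightarrow> rvec set" where
  "interior_Rn n U \<equiv> top_of_set (Rn n) interior_of U"

lemma eventually_line_in_openin:
  assumes "openin (top_of_set (Rn n)) \<Omega>" "x \<in> \<Omega>" "w \<in> Rn n"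
  shows "\<forall>\<^sub>F t in nhds 0. x + t *\<^sub>R w \<in> \<Omega>"
proof -
  obtain W where W: "open W" "\<Omega> = Rn n \<inter> W"
    using assms(1) by (auto simp: openin_open)
  have "open ((\<lambda>t. x + t *\<^sub>R w) -` W)"
    by (intro open_vimage W continuous_intros)
  then have "\<forall>\<^sub>F t in nhds 0. t \<in> (\<lambda>t. x + t *\<^sub>R w) -` W"
    using assms W by (intro eventually_nhds_in_open) auto
  then show ?thesis
    by (rule eventually_mono) (use assms W in \<open>auto simp: Rn_closed\<close>)
qed

text \<open>Each derivative looks only at a short segment around the point, and this segment stays
  in the relatively open set because the directions lie in \<open>Rn n\<close>. The induction needs
  arbitrary \<open>x\<close>, since the inner derivative is taken at displaced points.\<close>

lemma iter_dir_deriv_cong: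
  assumes \<Omega>: "openin (top_of_set (Rn n)) \<Omega>" and eq: "\<And>x. x \<in> \<Omega> \<Longrightarrow> f x = g x"
    and "x \<in> \<Omega>" "\<And>i. i < k \<Longrightarrow> v i \<in> Rn n"
  shows "iter_dir_deriv k f v x = iter_dir_deriv k g v x"
  using assms(3,4)
proof (induction k arbitrary: x)
  case 0
  then show ?case by (simp add: eq)
next
  case (Suc k)
  have "\<forall>\<^sub>F t in nhds 0. x + t *\<^sub>R v k \<in> \<Omega>"
    using \<Omega> Suc.prems by (intro eventually_line_in_openin) auto
  then have "\<forall>\<^sub>F t in nhds 0. t \<in> UNIV \<longrightarrow>
      iter_dir_deriv k f v (x + t *\<^sub>R v k) = iter_dir_deriv k g v (x + t *\<^sub>R v k)"
    by (rule eventually_mono) (use Suc in auto)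
  then show ?case
    by (auto intro: vector_derivative_cong_eq)
qed

lemma has_vector_derivative_affine_line:
  assumes "bounded_linear L"
  shows "((\<lambda>t. p + L (x + t *\<^sub>R w)) has_vector_derivative L w) (at t)"
proof -
  have "((\<lambda>t. p + (L x + t *\<^sub>R L w)) has_vector_derivative L w) (at t)"
    by (auto intro!: derivative_eq_intros)
  then show ?thesis
    by (simp add: linear_add linear_scale bounded_linear.linear[OF assms])
qed

lemma iter_dir_deriv_affine:
  assumes "bounded_linear L"
  shows "iter_dir_deriv k (\<lambda>x. p + L x) v x =
    (if k = 0 then p + L x else if k = 1 then L (v 0) else 0)"
proof (induction k arbitrary: x)
  case (Suc k)
  show ?case
  proof (cases "k = 0")
    case True
    then show ?thesis
      by (simp add: vector_derivative_at[OF has_vector_derivative_affine_line[OF assms]])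
  next
    case False
    then have "(\<lambda>t. iter_dir_deriv k (\<lambda>x. p + L x) v (x + t *\<^sub>R v k)) = (\<lambda>t. if k = 1 then L (v 0) else 0)"
      by (simp add: Suc.IH)
    then show ?thesis using False by simp
  qed
qed simp

text \<open>The charts built for a simple polytope and their inverses are of this form. The closed
  formula for the iterated derivatives is continuous everywhere, so the same formula is the
  extension that smoothness on \<open>U\<close> demands.\<close>

lemma smooth_map_affine:
  assumes L: "bounded_linear L" and eq: "\<And>x. x \<in> U \<Longrightarrow> f x = p + L x"
    and f: "f \<in> U \<rightarrow> Rn d" and LRn: "\<And>w. w \<in> Rn n \<Longrightarrow> L w \<in> Rn d"
  shows "smooth_map n d U f"
proof -
  let ?\<Omega> = "interior_Rn n U"
  let ?G = "\<lambda>(k::nat) (x, v). if k = 0 then p + L x else if k = 1 then L (v 0) else 0"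
  have sub: "?\<Omega> \<subseteq> U" by (rule interior_of_subset)
  have eqG: "iter_dir_deriv k f v x = ?G k (x, v)" if "x \<in> ?\<Omega>" "v \<in> {..<k} \<rightarrow>\<^sub>E Rn n" for k x v
  proof -
    have "iter_dir_deriv k f v x = iter_dir_deriv k (\<lambda>x. p + L x) v x"
      by (rule iter_dir_deriv_cong[OF openin_interior_of eq[OF subsetD[OF sub]]])
        (use that in \<open>auto simp: PiE_iff\<close>)
    then show ?thesis by (simp add: iter_dir_deriv_affine[OF L])
  qed
  have contG: "continuous_on S (?G k)" for S :: "(rvec \<times> (nat \<Rightarrow> rvec)) set" and k
  proof -
    have "continuous_on S (\<lambda>x. snd x (0::nat))"
      by (rule continuous_on_product_then_coordinatewise[of S snd])
        (intro continuous_on_snd continuous_on_id)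
    then have "continuous_on S (\<lambda>x. L (snd x 0))"
      by (rule bounded_linear.continuous_on[OF L])
    moreover have "continuous_on S (\<lambda>x. p + L (fst x))"
      by (intro continuous_on_add continuous_on_const bounded_linear.continuous_on[OF L]
          continuous_on_fst continuous_on_id)
    ultimately show ?thesis
      by (cases "k = 0"; cases "k = 1") (simp_all add: case_prod_unfold)
  qed
  have "(\<lambda>t. iter_dir_deriv k f v (x + t *\<^sub>R v k)) differentiable at 0"
    if x: "x \<in> ?\<Omega>" and v: "v \<in> {..<Suc k} \<rightarrow>\<^sub>E Rn n" for k x v
  proof -
    have vk: "v i \<in> Rn n" if "i < Suc k" for i
      using v that by (auto simp: PiE_iff)
    have ev: "\<forall>\<^sub>F t in nhds 0. x + t *\<^sub>R v k \<in> ?\<Omega>"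
      by (rule eventually_line_in_openin[OF openin_interior_of x vk]) simp
    have eqk: "iter_dir_deriv k f v (x + t *\<^sub>R v k) = iter_dir_deriv k (\<lambda>x. p + L x) v (x + t *\<^sub>R v k)"
      if "x + t *\<^sub>R v k \<in> ?\<Omega>" for t
      by (rule iter_dir_deriv_cong[OF openin_interior_of eq[OF subsetD[OF sub]]]) (use that vk in \<open>auto simp: less_Suc_eq\<close>)
    have ev: "\<forall>\<^sub>F t in nhds 0. ?G k (x + t *\<^sub>R v k, v) = iter_dir_deriv k f v (x + t *\<^sub>R v k)"
      by (rule eventually_mono[OF ev]) (simp add: eqk iter_dir_deriv_affine[OF L])
    have "\<exists>D. ((\<lambda>t. ?G k (x + t *\<^sub>R v k, v)) has_vector_derivative D) (at 0)"
      using has_vector_derivative_affine_line[OF L, of p x "v k" 0]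
      by (cases "k = 0"; cases "k = 1") (auto intro: exI[of _ 0])
    then obtain D where "((\<lambda>t. ?G k (x + t *\<^sub>R v k, v)) has_vector_derivative D) (at 0)" ..
    moreover have "((\<lambda>t. ?G k (x + t *\<^sub>R v k, v)) has_vector_derivative D) (at 0) \<longleftrightarrow>
        ((\<lambda>t. iter_dir_deriv k f v (x + t *\<^sub>R v k)) has_vector_derivative D) (at 0)"
      by (rule has_vector_derivative_cong_ev)
        (rule eventually_mono[OF ev], simp, rule eventually_nhds_x_imp_x[OF ev])
    ultimately have "((\<lambda>t. iter_dir_deriv k f v (x + t *\<^sub>R v k)) has_vector_derivative D) (at 0)"
      by iprover
    then show ?thesis by (rule differentiableI_vector)
  qed
  moreover have "continuous_on (?\<Omega> \<times> ({..<k} \<rightarrow>\<^sub>E Rn n)) (\<lambda>(x, v). iter_dir_deriv k f v x)" for k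
    by (rule continuous_on_eq[OF contG[of _ k]]) (use eqG in auto)
  ultimately have "smooth_on_open n ?\<Omega> f"
    unfolding smooth_on_open_def by blast
  moreover have "continuous_on U f"
    by (rule continuous_on_eq[of _ "\<lambda>x. p + L x"])
      (auto simp: eq intro!: continuous_intros bounded_linear.continuous_on[OF L])
  moreover have "\<exists>g. g \<in> U \<times> ({..<k} \<rightarrow>\<^sub>E Rn n) \<rightarrow> Rn d \<and>
        continuous_on (U \<times> ({..<k} \<rightarrow>\<^sub>E Rn n)) g \<and>
        (\<forall>x \<in> ?\<Omega>. \<forall>v \<in> {..<k} \<rightarrow>\<^sub>E Rn n. g (x, v) = iter_dir_deriv k f v x)" for k
  proof (intro exI[of _ "?G k"] conjI ballI)
    show "?G k \<in> U \<times> ({..<k} \<rightarrow>\<^sub>E Rn n) \<rightarrow> Rn d"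
      using f eq LRn by (auto simp: Rn_closed PiE_iff Pi_iff)
  qed (use eqG contG in auto)
  ultimately show ?thesis
    unfolding smooth_map_def using f by blast
qed

text \<open>The bound on \<open>H\<close> is a bound on its difference quotients and survives the
  limit. It will show that the defect of additivity of directional derivatives is arbitrarily
  small.\<close>

lemma norm_vector_derivative_le:
  assumes H: "(H has_vector_derivative D) (at (0::real))" and "H 0 = 0"
    and e: "\<forall>\<^sub>F t in nhds 0. norm (H t) \<le> e * \<bar>t\<bar>"
  shows "norm D \<le> e"
proof -
  have "((\<lambda>h. norm (H (0 + h) - H 0 - h *\<^sub>R D) / norm h) \<longlongrightarrow> 0) (at 0)"
    using H unfolding has_vector_derivative_def has_derivative_at by blast
  then have lim: "((\<lambda>h. norm (H h - h *\<^sub>R D) / \<bar>h\<bar> + e) \<longlongrightarrow> 0 + e) (at 0)"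
    using \<open>H 0 = 0\<close> by (intro tendsto_intros) auto
  have "norm D \<le> norm (H h - h *\<^sub>R D) / \<bar>h\<bar> + e" if "h \<noteq> 0" "norm (H h) \<le> e * \<bar>h\<bar>" for h
  proof -
    have "\<bar>h\<bar> * norm D \<le> norm (H h - h *\<^sub>R D) + norm (H h)"
      using norm_triangle_ineq4[of "H h" "H h - h *\<^sub>R D"] by simp
    then show ?thesis using that by (simp add: field_simps)
  qed
  then have "\<forall>\<^sub>F h in at 0. norm D \<le> norm (H h - h *\<^sub>R D) / \<bar>h\<bar> + e"
    using e by (auto simp: eventually_at_filter elim!: eventually_mono)
  with lim show ?thesis
    by (intro tendsto_lowerbound[OF lim, simplified]) auto
qed

section \<open>Directional derivatives\<close>

text \<open>The first-order content of smoothness. Freezing the direction tuple at the one-entry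
  tuple \<open>?v w\<close> turns joint continuity in point and direction into continuity in the
  point for each fixed direction.\<close>

lemma smooth_map_directional_derivative:
  assumes "smooth_map n d U \<phi>"
  obtains G where
    "\<And>x w. x \<in> interior_Rn n U \<Longrightarrow> w \<in> Rn n \<Longrightarrow>
      ((\<lambda>t. \<phi> (x + t *\<^sub>R w)) has_vector_derivative G x w) (at 0)"
    "\<And>w. w \<in> Rn n \<Longrightarrow> continuous_on U (\<lambda>x. G x w)"
    "\<And>x w. x \<in> U \<Longrightarrow> w \<in> Rn n \<Longrightarrow> G x w \<in> Rn d"
proof -
  let ?v = "\<lambda>w. \<lambda>i\<in>{..<1::nat}. w"
  obtain g where gR: "g \<in> U \<times> ({..<1} \<rightarrow>\<^sub>E Rn n) \<rightarrow> Rn d"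
    and gc: "continuous_on (U \<times> ({..<1} \<rightarrow>\<^sub>E Rn n)) g"
    and g: "\<And>x v. x \<in> interior_Rn n U \<Longrightarrow> v \<in> {..<1} \<rightarrow>\<^sub>E Rn n \<Longrightarrow> g (x, v) = iter_dir_deriv 1 \<phi> v x"
    using assms unfolding smooth_map_def by meson
  have diff: "(\<lambda>t. \<phi> (x + t *\<^sub>R v 0)) differentiable (at 0)"
    if "x \<in> interior_Rn n U" "v \<in> {..<Suc 0} \<rightarrow>\<^sub>E Rn n" for x v
  proof -
    have "smooth_on_open n (interior_Rn n U) \<phi>"
      using assms by (simp add: smooth_map_def)
    then have "\<forall>x\<in>interior_Rn n U. \<forall>v \<in> {..<Suc 0} \<rightarrow>\<^sub>E Rn n.
        (\<lambda>t. iter_dir_deriv 0 \<phi> v (x + t *\<^sub>R v 0)) differentiable (at 0)"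
      unfolding smooth_on_open_def by (elim conjE) (erule allE)
    then show ?thesis using that by simp
  qed
  have v: "?v w \<in> {..<1} \<rightarrow>\<^sub>E Rn n" if "w \<in> Rn n" for w
    using that by auto
  show thesis
  proof (rule that[of "\<lambda>x w. g (x, ?v w)"])
    fix x w assume xw: "x \<in> interior_Rn n U" "w \<in> Rn n"
    show "((\<lambda>t. \<phi> (x + t *\<^sub>R w)) has_vector_derivative g (x, ?v w)) (at 0)"
      using diff[of x "?v w"] xw v[of w] g[OF xw(1) v[OF xw(2)]]
      by (simp add: vector_derivative_works)
  next
    fix w assume w: "w \<in> Rn n"
    show "continuous_on U (\<lambda>x. g (x, ?v w))"
    proof (rule continuous_on_compose2[OF gc])
      show "continuous_on U (\<lambda>x. (x, ?v w))"
        by (intro continuous_on_Pair continuous_on_id continuous_on_const)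
      show "(\<lambda>x. (x, ?v w)) ` U \<subseteq> U \<times> ({..<1} \<rightarrow>\<^sub>E Rn n)"
        using v[OF w] by blast
    qed
  next
    fix x w assume "x \<in> U" "w \<in> Rn n"
    then show "g (x, ?v w) \<in> Rn d" using gR v by blast
  qed
qed

text \<open>The setting of the classical theorem that directional derivatives which are continuous
  in the point are linear in the direction.\<close>

context
  fixes n :: nat and \<Omega> :: "rvec set" and \<phi> :: "rvec \<Rightarrow> rvec" and G :: "rvec \<Rightarrow> rvec \<Rightarrow> rvec"
  assumes \<Omega>: "openin (top_of_set (Rn n)) \<Omega>"
    and deriv: "\<And>x w. x \<in> \<Omega> \<Longrightarrow> w \<in> Rn n \<Longrightarrow>
      ((\<lambda>t. \<phi> (x + t *\<^sub>R w)) has_vector_derivative G x w) (at 0)"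
    and cont: "\<And>w. w \<in> Rn n \<Longrightarrow> continuous_on \<Omega> (\<lambda>x. G x w)"
begin

text \<open>Subtracting the linear term with slope \<open>D\<close> from the path leaves a path of
  speed at most \<open>e\<close>, to which the mean value inequality for vector-valued maps
  applies.\<close>

lemma directional_mean_value:
  assumes w: "w \<in> Rn n" and seg: "\<And>s. s \<in> {0..1} \<Longrightarrow> x + s *\<^sub>R w \<in> \<Omega>"
    and bound: "\<And>s. s \<in> {0..1} \<Longrightarrow> norm (G (x + s *\<^sub>R w) w - D) \<le> e"
  shows "norm (\<phi> (x + w) - \<phi> x - D) \<le> e"
proof -
  define h where "h = (\<lambda>s. \<phi> (x + s *\<^sub>R w) - s *\<^sub>R D)"
  have h: "(h has_vector_derivative (G (x + s *\<^sub>R w) w - D)) (at s)" if "s \<in> {0..1}" for s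
  proof -
    \<comment> \<open>\<open>deriv\<close> speaks of parameter 0 only; composing with the shift
      moves the derivative to parameter \<open>s\<close>.\<close>
    have "((\<lambda>t. t - s) has_vector_derivative 1) (at s)"
      by (auto intro!: derivative_eq_intros)
    then have "((\<lambda>t. \<phi> ((x + s *\<^sub>R w) + t *\<^sub>R w)) \<circ> (\<lambda>t. t - s) has_vector_derivative
        1 *\<^sub>R G (x + s *\<^sub>R w) w) (at s)"
      by (rule vector_diff_chain_at) (use deriv[OF seg[OF that] w] in simp)
    then have "((\<lambda>t. \<phi> (x + t *\<^sub>R w)) has_vector_derivative G (x + s *\<^sub>R w) w) (at s)"
      by (simp add: o_def algebra_simps)
    then show ?thesis
      unfolding h_def by (auto intro!: derivative_eq_intros)
  qed
  have "norm (h 1 - h 0) \<le> e * 1 - e * 0"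
  proof (rule differentiable_bound_general)
    show "continuous_on {0..1} h"
      by (meson continuous_at_imp_continuous_on h has_vector_derivative_continuous)
    show "((*) e has_vector_derivative e) (at s)" for s
      by (auto intro!: derivative_eq_intros)
    show "(h has_vector_derivative (G (x + s *\<^sub>R w) w - D)) (at s)"
      "norm (G (x + s *\<^sub>R w) w - D) \<le> e" if "0 < s" "s < 1" for s
      using that h bound by auto
  qed (auto intro!: continuous_intros)
  then show ?thesis by (simp add: h_def algebra_simps)
qed

lemma directional_derivative_scaleR:
  assumes x: "x \<in> \<Omega>" and w: "w \<in> Rn n"
  shows "G x (c *\<^sub>R w) = c *\<^sub>R G x w"
proof -
  have "((\<lambda>t. c * t) has_vector_derivative c) (at 0)"
    by (auto intro!: derivative_eq_intros)
  then have "((\<lambda>t. \<phi> (x + t *\<^sub>R w)) \<circ> (\<lambda>t. c * t) has_vector_derivative c *\<^sub>R G x w) (at 0)"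
    by (rule vector_diff_chain_at) (use deriv[OF x w] in simp)
  then have "((\<lambda>t. \<phi> (x + t *\<^sub>R c *\<^sub>R w)) has_vector_derivative c *\<^sub>R G x w) (at 0)"
    by (simp add: o_def mult.commute)
  with deriv[OF x, of "c *\<^sub>R w"] w show ?thesis
    by (auto intro: vector_derivative_unique_at simp: Rn_closed)
qed

text \<open>Going from \<open>x + t w1\<close> to \<open>x + t (w1 + w2)\<close> is a move in
  direction \<open>w2\<close> near \<open>x\<close>. By the mean value bound and continuity of
  \<open>G\<close> in the point, the increment is \<open>t G x w2\<close> up to
  \<open>e |t|\<close>. So the path \<open>H\<close>, whose derivative at 0 is the defect
  \<open>D\<close>, satisfies \<open>norm (H t)\<close> at most \<open>e |t|\<close>.\<close>

lemma directional_derivative_add: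
  assumes x: "x \<in> \<Omega>" and w1: "w1 \<in> Rn n" and w2: "w2 \<in> Rn n"
  shows "G x (w1 + w2) = G x w1 + G x w2"
proof -
  define D where "D = G x (w1 + w2) - G x w1 - G x w2"
  define H where "H = (\<lambda>t. \<phi> (x + t *\<^sub>R (w1 + w2)) - \<phi> (x + t *\<^sub>R w1) - t *\<^sub>R G x w2)"
  have H: "(H has_vector_derivative D) (at 0)"
    unfolding H_def D_def
    by (intro has_vector_derivative_diff deriv x w1 w2 Rn_closed)
      (auto intro!: derivative_eq_intros)
  have "norm D \<le> e" if "e > 0" for e
  proof (rule norm_vector_derivative_le[OF H])
    show "H 0 = 0" by (simp add: H_def)
    obtain \<delta>1 where \<delta>1: "\<delta>1 > 0" "\<And>z. z \<in> \<Omega> \<Longrightarrow> dist z x < \<delta>1 \<Longrightarrow> dist (G z w2) (G x w2) < e"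
      using cont[OF w2] x \<open>e > 0\<close> unfolding continuous_on_iff by metis
    obtain \<delta>2 where \<delta>2: "\<delta>2 > 0" "\<And>z. z \<in> Rn n \<Longrightarrow> dist z x < \<delta>2 \<Longrightarrow> z \<in> \<Omega>"
      using \<Omega> x unfolding openin_euclidean_subtopology_iff by metis
    \<comment> \<open>All points met have the form \<open>x + t w1 + s t w2\<close> with
      \<open>s\<close> in [0, 1], hence lie within \<open>|t|\<close> times the denominator of
      \<open>x\<close>. The summand 1 keeps the denominator positive.\<close>
    define \<delta> where "\<delta> = min \<delta>1 \<delta>2 / (norm w1 + norm w2 + 1)"
    have \<delta>: "\<delta> > 0" using \<delta>1 \<delta>2 by (auto simp: \<delta>_def add_nonneg_pos)
    have xR: "x \<in> Rn n" using x \<Omega> openin_imp_subset by blast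
    have "norm (H t) \<le> e * \<bar>t\<bar>" if t: "\<bar>t\<bar> < \<delta>" for t
    proof -
      have near: "dist ((x + t *\<^sub>R w1) + s *\<^sub>R t *\<^sub>R w2) x < min \<delta>1 \<delta>2" if "s \<in> {0..1}" for s
      proof -
        have "norm (t *\<^sub>R w1 + s *\<^sub>R t *\<^sub>R w2) \<le> \<bar>t\<bar> * norm w1 + \<bar>s\<bar> * (\<bar>t\<bar> * norm w2)"
          by (rule order_trans[OF norm_triangle_ineq]) (simp add: abs_mult mult.assoc)
        also have "\<dots> \<le> \<bar>t\<bar> * norm w1 + 1 * (\<bar>t\<bar> * norm w2)"
          using that by (intro add_left_mono mult_right_mono) auto
        also have "\<dots> \<le> \<bar>t\<bar> * (norm w1 + norm w2 + 1)"
          by (simp add: algebra_simps)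
        also have "\<dots> < \<delta> * (norm w1 + norm w2 + 1)"
          using t by (intro mult_strict_right_mono) (auto simp: add_nonneg_pos)
        also have "\<dots> = min \<delta>1 \<delta>2"
          unfolding \<delta>_def by (smt (verit) norm_ge_zero nonzero_eq_divide_eq)
        finally show ?thesis by (simp add: dist_norm algebra_simps)
      qed
      have inO: "(x + t *\<^sub>R w1) + s *\<^sub>R t *\<^sub>R w2 \<in> \<Omega>" if "s \<in> {0..1}" for s
        using \<delta>2(2) near[OF that] xR w1 w2 by (simp add: Rn_closed)
      have "norm (\<phi> ((x + t *\<^sub>R w1) + t *\<^sub>R w2) - \<phi> (x + t *\<^sub>R w1) - t *\<^sub>R G x w2) \<le> e * \<bar>t\<bar>"
      proof (rule directional_mean_value)
        fix s :: real assume s: "s \<in> {0..1}"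
        let ?z = "(x + t *\<^sub>R w1) + s *\<^sub>R t *\<^sub>R w2"
        have "norm (G ?z w2 - G x w2) \<le> e"
          using \<delta>1(2)[OF inO[OF s]] near[OF s] by (simp add: dist_norm)
        then have "\<bar>t\<bar> * norm (G ?z w2 - G x w2) \<le> e * \<bar>t\<bar>"
          by (metis abs_ge_zero mult.commute mult_right_mono)
        then show "norm (G ?z (t *\<^sub>R w2) - t *\<^sub>R G x w2) \<le> e * \<bar>t\<bar>"
          unfolding directional_derivative_scaleR[OF inO[OF s] w2]
          by (metis norm_scaleR scaleR_diff_right)
      qed (use inO w2 in \<open>auto simp: Rn_closed\<close>)
      then show ?thesis by (simp add: H_def algebra_simps)
    qed
    then show "\<forall>\<^sub>F t in nhds 0. norm (H t) \<le> e * \<bar>t\<bar>"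
      using \<delta> by (auto simp: eventually_nhds_metric dist_real_def)
  qed
  then have "norm D \<le> 0" by (meson field_le_epsilon add_0 order_trans order_refl dense_ge)
  then show ?thesis by (simp add: D_def algebra_simps)
qed

lemma directional_derivative_eq_lincomb:
  assumes x: "x \<in> \<Omega>" and w: "w \<in> Rn n"
  shows "G x w = lincomb n (\<lambda>i. G x (Poly_Mapping.single i 1)) w"
proof -
  \<comment> \<open>Additivity of \<open>G x\<close> is known on \<open>Rn n\<close> only, so the
    general rule for linear maps of sums does not apply and the induction keeps the partial sums in
    \<open>Rn n\<close>.\<close>
  have "G x (\<Sum>i\<in>A. t i *\<^sub>R Poly_Mapping.single i 1) = (\<Sum>i\<in>A. t i *\<^sub>R G x (Poly_Mapping.single i 1))"
    if "finite A" "A \<subseteq> {..<n}" for A and t :: "nat \<Rightarrow> real"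
    using that
  proof (induction A rule: finite_induct)
    case empty
    show ?case using directional_derivative_scaleR[OF x w, of 0] by simp
  next
    case (insert j A)
    have "(\<Sum>i\<in>A. t i *\<^sub>R Poly_Mapping.single i (1::real)) \<in> Rn n"
      using insert.prems by (intro subspace_sum[OF subspace_Rn]) (auto intro!: Rn_closed single_in_Rn)
    then show ?case
      using insert by (simp add: directional_derivative_add[OF x] directional_derivative_scaleR[OF x]
          Rn_closed single_in_Rn)
  qed
  from this[of "{..<n}" "Poly_Mapping.lookup w"] show ?thesis
    using rvec_of_lookup[OF w] by (simp add: rvec_of_def lincomb_def)
qed

end

section \<open>Tangent cones of polyhedral regions\<close>

text \<open>The point \<open>q\<close> witnesses that the region has non-empty interior in \<open>Rn n\<close>.\<close>

locale polyhedral_region =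
  fixes n :: nat and J :: "'j set" and \<beta> :: "'j \<Rightarrow> real" and l :: "'j \<Rightarrow> rvec \<Rightarrow> real" and q :: rvec
  assumes finite_J: "finite J" and l: "\<And>j. j \<in> J \<Longrightarrow> bounded_linear (l j)"
    and q: "q \<in> Rn n" "\<And>j. j \<in> J \<Longrightarrow> 0 < \<beta> j + l j q"
begin

section \<open>Interior points, segments and derivatives in polyhedral regions\<close>

definition region :: "rvec set" where
  "region = {x \<in> Rn n. \<forall>j\<in>J. 0 \<le> \<beta> j + l j x}"

text \<open>For \<open>x\<close> in the region this is the tangent cone, written through the
  constraints active at \<open>x\<close>. Because there are finitely many affine constraints, these
  are exactly the directions in which a short segment stays in the region.\<close>

definition tangent :: "rvec \<Rightarrow> rvec set" where
  "tangent x = {w \<in> Rn n. \<forall>j\<in>J. \<beta> j + l j x = 0 \<longrightarrow> 0 \<le> l j w}"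

lemma l_add: "j \<in> J \<Longrightarrow> l j (x + y) = l j x + l j y"
  and l_scaleR: "j \<in> J \<Longrightarrow> l j (c *\<^sub>R x) = c * l j x"
  and l_diff: "j \<in> J \<Longrightarrow> l j (x - y) = l j x - l j y"
  using l by (auto simp: linear_add linear_scale linear_diff bounded_linear.linear)

lemma mem_interiorI:
  assumes "openin (top_of_set region) U" "z \<in> U" "\<And>j. j \<in> J \<Longrightarrow> 0 < \<beta> j + l j z"
  shows "z \<in> interior_Rn n U"
proof -
  obtain W where W: "open W" "U = region \<inter> W"
    using assms(1) by (auto simp: openin_open)
  let ?T = "W \<inter> (\<Inter>j\<in>J. {x. 0 < \<beta> j + l j x})"
  have "open ?T"
    by (intro open_Int W open_INT finite_J ballI open_Collect_less continuous_on_const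
        continuous_on_add bounded_linear.continuous_on[OF l] continuous_on_id)
  then have "openin (top_of_set (Rn n)) (Rn n \<inter> ?T)"
    by (rule openin_open_Int)
  moreover have "Rn n \<inter> ?T \<subseteq> U"
    using W by (auto simp: region_def less_imp_le)
  moreover have "z \<in> Rn n \<inter> ?T"
    using assms W by (auto simp: region_def)
  ultimately show ?thesis
    unfolding interior_of_def by blast
qed

text \<open>Each slack is affine along the segment from \<open>u\<close> to \<open>q\<close>,
  nonnegative at \<open>u\<close> and positive at \<open>q\<close>, so it is positive as soon as
  \<open>s\<close> is.\<close>

lemma shrink_towards_q:
  assumes "u \<in> region" "0 < s" "s \<le> 1"
  shows "u + s *\<^sub>R (q - u) \<in> region" "j \<in> J \<Longrightarrow> 0 < \<beta> j + l j (u + s *\<^sub>R (q - u))"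
proof -
  have pos: "0 < \<beta> j + l j (u + s *\<^sub>R (q - u))" if "j \<in> J" for j
  proof -
    have "0 < (1 - s) * (\<beta> j + l j u) + s * (\<beta> j + l j q)"
      by (rule add_nonneg_pos[OF mult_nonneg_nonneg mult_pos_pos])
        (use assms q that in \<open>auto simp: region_def\<close>)
    then show ?thesis
      using that by (simp add: l_add l_diff l_scaleR algebra_simps)
  qed
  then show "u + s *\<^sub>R (q - u) \<in> region"
    using assms q by (auto simp: region_def Rn_closed less_imp_le)
  show "j \<in> J \<Longrightarrow> 0 < \<beta> j + l j (u + s *\<^sub>R (q - u))" by (rule pos)
qed

lemma convex_region:
  assumes "x \<in> region" "y \<in> region" "0 \<le> t" "t \<le> 1"
  shows "x + t *\<^sub>R (y - x) \<in> region"
proof -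
  have "0 \<le> \<beta> j + l j (x + t *\<^sub>R (y - x))" if "j \<in> J" for j
  proof -
    have "0 \<le> (1 - t) * (\<beta> j + l j x) + t * (\<beta> j + l j y)"
      by (rule add_nonneg_nonneg[OF mult_nonneg_nonneg mult_nonneg_nonneg])
        (use assms that in \<open>auto simp: region_def\<close>)
    then show ?thesis
      using that by (simp add: l_add l_diff l_scaleR algebra_simps)
  qed
  then show ?thesis
    using assms by (auto simp: region_def Rn_closed)
qed

text \<open>The mean value theorem along segments pushed slightly towards \<open>q\<close>, hence into the interior,
  bounds the error of the linear approximation; letting the push tend to 0 reaches the boundary.\<close>

lemma smooth_map_has_derivative:
  assumes U: "openin (top_of_set region) U" and x0: "x0 \<in> U" and \<phi>: "smooth_map n d U \<phi>"
  obtains A where "bounded_linear A" "(\<phi> has_derivative A) (at x0 within U)"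
    "\<And>w. A w \<in> Rn d"
proof -
  let ?\<Omega> = "interior_Rn n U" and ?e = "\<lambda>i. Poly_Mapping.single i (1::real)"
  obtain W where W: "open W" "U = region \<inter> W"
    using U by (auto simp: openin_open)
  have \<phi>c: "continuous_on U \<phi>"
    using \<phi> by (simp add: smooth_map_def)
  obtain G where deriv: "\<And>x w. x \<in> ?\<Omega> \<Longrightarrow> w \<in> Rn n \<Longrightarrow>
      ((\<lambda>t. \<phi> (x + t *\<^sub>R w)) has_vector_derivative G x w) (at 0)"
    and contU: "\<And>w. w \<in> Rn n \<Longrightarrow> continuous_on U (\<lambda>x. G x w)"
    and GR: "\<And>x w. x \<in> U \<Longrightarrow> w \<in> Rn n \<Longrightarrow> G x w \<in> Rn d"
    using smooth_map_directional_derivative[OF \<phi>] by metis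
  have cont: "continuous_on ?\<Omega> (\<lambda>x. G x w)" if "w \<in> Rn n" for w
    by (rule continuous_on_subset[OF contU[OF that] interior_of_subset])
  have G_lincomb: "G x w = lincomb n (\<lambda>i. G x (?e i)) w" if "x \<in> ?\<Omega>" "w \<in> Rn n" for x w
    by (rule directional_derivative_eq_lincomb[OF openin_interior_of _ _ that]) (fact deriv, fact cont)
  have mean_value: "norm (\<phi> (x + w) - \<phi> x - D) \<le> c" if "w \<in> Rn n"
    "\<And>s. s \<in> {0..1} \<Longrightarrow> x + s *\<^sub>R w \<in> ?\<Omega>"
    "\<And>s. s \<in> {0..1} \<Longrightarrow> norm (G (x + s *\<^sub>R w) w - D) \<le> c" for x w D c
    by (rule directional_mean_value[where G = G, OF openin_interior_of]) (fact deriv cont that)+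
  \<comment> \<open>At a boundary point \<open>G x0\<close> is only a continuous extension and its
    linearity is not yet available; the candidate derivative is therefore assembled from its values
    on the unit vectors.\<close>
  define A where "A = lincomb n (\<lambda>i. G x0 (?e i))"
  have A: "bounded_linear A"
    unfolding A_def by (rule bounded_linear_lincomb)
  have "(\<phi> has_derivative A) (at x0 within U)"
    unfolding has_derivative_within_alt
  proof (intro conjI A allI impI)
    fix e :: real assume e: "e > 0"
    have "\<forall>\<^sub>F z in at x0 within U. dist (G z (?e i)) (G x0 (?e i)) < e" if "i < n" for i
      using contU[OF single_in_Rn[OF that]] x0 e by (auto simp: continuous_on_def intro: tendstoD)
    then have "\<forall>\<^sub>F z in at x0 within U. \<forall>i\<in>{..<n}. dist (G z (?e i)) (G x0 (?e i)) < e"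
      by (intro eventually_ball_finite) auto
    then obtain \<delta>0 where \<delta>0: "\<delta>0 > 0"
      "\<And>z i. z \<in> U \<Longrightarrow> dist z x0 < \<delta>0 \<Longrightarrow> i < n \<Longrightarrow> dist (G z (?e i)) (G x0 (?e i)) < e"
      using e unfolding eventually_at by (metis dist_self lessThan_iff)
    obtain \<delta>1 where \<delta>1: "\<delta>1 > 0" "\<And>z. dist z x0 < \<delta>1 \<Longrightarrow> z \<in> W"
      using W x0 unfolding open_dist by blast
    define \<delta> where "\<delta> = min \<delta>0 \<delta>1"
    have G_near: "norm (G z w - A w) \<le> e * norm w"
      if z: "z \<in> ?\<Omega>" "dist z x0 < \<delta>" and w: "w \<in> Rn n" for z w
    proof -
      have zU: "z \<in> U" by (rule subsetD[OF interior_of_subset z(1)])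
      have "G z w - A w = (\<Sum>i<n. Poly_Mapping.lookup w i *\<^sub>R (G z (?e i) - G x0 (?e i)))"
        unfolding G_lincomb[OF z(1) w] A_def lincomb_def
        by (simp add: scaleR_diff_right sum_subtractf)
      also have "norm \<dots> \<le> (\<Sum>i<n. \<bar>Poly_Mapping.lookup w i\<bar> * e)"
      proof (rule sum_norm_le)
        fix i assume "i \<in> {..<n}"
        then show "norm (Poly_Mapping.lookup w i *\<^sub>R (G z (?e i) - G x0 (?e i))) \<le> \<bar>Poly_Mapping.lookup w i\<bar> * e"
          using \<delta>0(2)[OF zU, of i] z(2) by (simp add: \<delta>_def mult_left_mono flip: dist_norm)
      qed
      also have "\<dots> = e * norm w"
        by (simp add: norm_Rn[OF w] sum_distrib_left mult.commute)
      finally show ?thesis .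
    qed
    show "\<exists>\<delta>>0. \<forall>y\<in>U. norm (y - x0) < \<delta> \<longrightarrow> norm (\<phi> y - \<phi> x0 - A (y - x0)) \<le> e * norm (y - x0)"
    proof (intro exI[of _ \<delta>] conjI ballI impI)
      show "\<delta> > 0" using \<delta>0 \<delta>1 by (simp add: \<delta>_def)
      fix y assume y: "y \<in> U" and near: "norm (y - x0) < \<delta>"
      define \<rho> where "\<rho> = norm (y - x0)"
      define p where "p = (\<lambda>s u. u + s *\<^sub>R (q - u))"
      \<comment> \<open>Pushing a point of the segment from \<open>x0\<close> to \<open>y\<close> by
        the fraction \<open>s\<close> towards \<open>q\<close> puts it at distance at most
        \<open>\<rho> + s (norm (q - x0) + \<rho> + 1)\<close> from \<open>x0\<close>. Below
        \<open>s1\<close> this is less than \<open>\<delta>\<close>, so the whole pushed segment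
        stays where \<open>G\<close> is within \<open>e\<close> of its value at \<open>x0\<close> on
        each unit vector.\<close>
      define s1 where "s1 = min 1 ((\<delta> - \<rho>) / (norm (q - x0) + \<rho> + 1))"
      have c: "norm (q - x0) + \<rho> + 1 > 0"
        unfolding \<rho>_def by (smt (verit) norm_ge_zero)
      have s1: "s1 > 0" using near c by (simp add: s1_def \<rho>_def)
      have xyR: "x0 \<in> region" "y \<in> region" using x0 y W by auto
      have Rn': "x0 \<in> Rn n" "y \<in> Rn n" using xyR by (auto simp: region_def)
      have seg: "p s (x0 + t *\<^sub>R (y - x0)) \<in> ?\<Omega> \<and> dist (p s (x0 + t *\<^sub>R (y - x0))) x0 < \<delta>"
        if s: "0 < s" "s < s1" and t: "0 \<le> t" "t \<le> 1" for s t
      proof -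
        let ?u = "x0 + t *\<^sub>R (y - x0)"
        have s': "s \<le> 1" using s by (simp add: s1_def)
        have u: "?u \<in> region"
          by (rule convex_region) (use xyR t in auto)
        have nu: "norm (?u - x0) \<le> \<rho>"
          using t mult_right_mono[of t 1 "norm (y - x0)"] by (simp add: \<rho>_def)
        have "norm (q - ?u) \<le> norm (q - x0) + norm (?u - x0)"
          by (metis diff_diff_eq2 diff_add_cancel norm_triangle_ineq4)
        then have nqu: "norm (q - ?u) \<le> norm (q - x0) + \<rho> + 1" using nu by simp
        have "dist (p s ?u) x0 = norm ((?u - x0) + s *\<^sub>R (q - ?u))"
          by (simp add: p_def dist_norm algebra_simps)
        also have "\<dots> \<le> norm (?u - x0) + s * norm (q - ?u)"
          using norm_triangle_ineq[of "?u - x0" "s *\<^sub>R (q - ?u)"] s by simp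
        also have "\<dots> \<le> \<rho> + s * (norm (q - x0) + \<rho> + 1)"
          using nu nqu s by (intro add_mono mult_left_mono) auto
        also have "\<dots> < \<delta>"
        proof -
          have "s < (\<delta> - \<rho>) / (norm (q - x0) + \<rho> + 1)" using s by (simp add: s1_def)
          then have "s * (norm (q - x0) + \<rho> + 1) < \<delta> - \<rho>"
            using c by (simp add: pos_less_divide_eq)
          then show ?thesis by simp
        qed
        finally have d: "dist (p s ?u) x0 < \<delta>" .
        have "p s ?u \<in> U"
          using shrink_towards_q(1)[OF u s(1) s'] \<delta>1(2) d W(2) by (auto simp: p_def \<delta>_def)
        then have "p s ?u \<in> ?\<Omega>"
          by (rule mem_interiorI[OF U]) (use shrink_towards_q(2)[OF u s(1) s'] in \<open>auto simp: p_def\<close>)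
        with d show ?thesis by simp
      qed
      have ineq: "norm (\<phi> (p s y) - \<phi> (p s x0) - A (p s y - p s x0)) \<le> e * norm (p s y - p s x0)"
        if s: "0 < s" "s < s1" for s
      proof -
        let ?w = "p s y - p s x0"
        have w: "?w = (1 - s) *\<^sub>R (y - x0)"
          by (simp add: p_def algebra_simps)
        then have wR: "?w \<in> Rn n" using Rn' by (simp add: Rn_closed)
        have pt: "p s x0 + t *\<^sub>R ?w = p s (x0 + t *\<^sub>R (y - x0))" for t
          by (simp add: p_def algebra_simps)
        have "norm (\<phi> (p s x0 + ?w) - \<phi> (p s x0) - A ?w) \<le> e * norm ?w"
        proof (rule mean_value[OF wR])
          fix t :: real assume t: "t \<in> {0..1}"
          then have z: "p s x0 + t *\<^sub>R ?w \<in> ?\<Omega>" "dist (p s x0 + t *\<^sub>R ?w) x0 < \<delta>"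
            unfolding pt using seg[OF s] by auto
          show "p s x0 + t *\<^sub>R ?w \<in> ?\<Omega>" by (rule z)
          show "norm (G (p s x0 + t *\<^sub>R ?w) ?w - A ?w) \<le> e * norm ?w"
            by (rule G_near[OF z wR])
        qed
        then show ?thesis by simp
      qed
      have p_tendsto: "((\<lambda>s. p s u) \<longlongrightarrow> u) (at_right 0)" for u
      proof -
        have "((\<lambda>s. p s u) \<longlongrightarrow> u + 0 *\<^sub>R (q - u)) (at_right 0)"
          unfolding p_def by (intro tendsto_intros)
        then show ?thesis by simp
      qed
      have ev: "\<forall>\<^sub>F s in at_right 0. 0 < s \<and> s < s1"
        using s1 by (auto simp: eventually_at_right_field)
      have \<phi>_tendsto: "((\<lambda>s. \<phi> (p s (x0 + t *\<^sub>R (y - x0)))) \<longlongrightarrow> \<phi> (x0 + t *\<^sub>R (y - x0))) (at_right 0)"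
        if t: "0 \<le> t" "t \<le> 1" "x0 + t *\<^sub>R (y - x0) \<in> U" for t
      proof (rule continuous_on_tendsto_compose[OF \<phi>c p_tendsto t(3)])
        show "\<forall>\<^sub>F s in at_right 0. p s (x0 + t *\<^sub>R (y - x0)) \<in> U"
          by (rule eventually_mono[OF ev])
            (metis seg t(1,2) interior_of_subset subsetD)
      qed
      have lx: "((\<lambda>s. \<phi> (p s x0)) \<longlongrightarrow> \<phi> x0) (at_right 0)"
        using \<phi>_tendsto[of 0] x0 by simp
      have ly: "((\<lambda>s. \<phi> (p s y)) \<longlongrightarrow> \<phi> y) (at_right 0)"
        using \<phi>_tendsto[of 1] y by simp
      show "norm (\<phi> y - \<phi> x0 - A (y - x0)) \<le> e * norm (y - x0)"
      proof (rule tendsto_le[OF trivial_limit_at_right_real])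
        show "((\<lambda>s. e * norm (p s y - p s x0)) \<longlongrightarrow> e * norm (y - x0)) (at_right 0)"
          by (intro tendsto_intros p_tendsto)
        show "((\<lambda>s. norm (\<phi> (p s y) - \<phi> (p s x0) - A (p s y - p s x0)))
            \<longlongrightarrow> norm (\<phi> y - \<phi> x0 - A (y - x0))) (at_right 0)"
          by (intro tendsto_norm tendsto_diff lx ly p_tendsto bounded_linear.tendsto[OF A])
        show "\<forall>\<^sub>F s in at_right 0. norm (\<phi> (p s y) - \<phi> (p s x0) - A (p s y - p s x0))
            \<le> e * norm (p s y - p s x0)"
          by (rule eventually_mono[OF ev]) (use ineq in auto)
      qed
    qed
  qed
  moreover have "A w \<in> Rn d" for w
    unfolding A_def by (rule lincomb_in_Rn) (use GR x0 single_in_Rn in blast)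
  ultimately show thesis using that A by blast
qed

text \<open>Active slacks start at 0 and do not decrease along \<open>w\<close>; inactive ones are
  positive and remain so for a while by continuity. Finiteness of \<open>J\<close> gives a common
  length.\<close>

lemma tangent_segment:
  assumes U: "openin (top_of_set region) U" and x0: "x0 \<in> U" and w: "w \<in> tangent x0"
  obtains \<delta> where "\<delta> > 0" "\<And>t. t \<in> {0..\<delta>} \<Longrightarrow> x0 + t *\<^sub>R w \<in> U"
proof -
  obtain W where W: "open W" "U = region \<inter> W"
    using U by (auto simp: openin_open)
  have x0R: "x0 \<in> region" "x0 \<in> W" using x0 W by auto
  have lim: "((\<lambda>t. x0 + t *\<^sub>R w) \<longlongrightarrow> x0) (at_right 0)"
  proof -
    have "((\<lambda>t. x0 + t *\<^sub>R w) \<longlongrightarrow> x0 + 0 *\<^sub>R w) (at_right 0)"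
      by (intro tendsto_intros)
    then show ?thesis by simp
  qed
  have pos: "\<forall>\<^sub>F t::real in at_right 0. 0 < t"
    by (simp add: eventually_at_right_less)
  have J: "\<forall>\<^sub>F t in at_right 0. 0 \<le> \<beta> j + l j (x0 + t *\<^sub>R w)" if j: "j \<in> J" for j
  proof (cases "\<beta> j + l j x0 = 0")
    case True
    with w j have "0 \<le> l j w" by (auto simp: tangent_def)
    with pos show ?thesis
      by (rule_tac eventually_mono[OF pos]) (use True j in \<open>auto simp: l_add l_scaleR simp flip: add.assoc\<close>)
  next
    case False
    then have "0 < \<beta> j + l j x0" using x0R j by (force simp: region_def)
    moreover have "((\<lambda>t. \<beta> j + l j (x0 + t *\<^sub>R w)) \<longlongrightarrow> \<beta> j + l j x0) (at_right 0)"
      by (intro tendsto_add tendsto_const bounded_linear.tendsto[OF l[OF j] lim])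
    ultimately show ?thesis
      by (auto dest: order_tendstoD(1) elim!: eventually_mono)
  qed
  have "\<forall>\<^sub>F t in at_right 0. x0 + t *\<^sub>R w \<in> W"
    using topological_tendstoD[OF lim W(1)] x0R by simp
  moreover have "\<forall>\<^sub>F t in at_right 0. \<forall>j\<in>J. 0 \<le> \<beta> j + l j (x0 + t *\<^sub>R w)"
    by (rule eventually_ball_finite[OF finite_J]) (use J in auto)
  ultimately have "\<forall>\<^sub>F t in at_right 0. x0 + t *\<^sub>R w \<in> U"
    by eventually_elim (use x0R w W in \<open>auto simp: region_def tangent_def Rn_closed\<close>)
  then obtain b where b: "b > 0" "\<And>t. 0 < t \<Longrightarrow> t < b \<Longrightarrow> x0 + t *\<^sub>R w \<in> U"
    by (auto simp: eventually_at_right_field)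
  show thesis
  proof (rule that[of "b / 2"])
    fix t assume "t \<in> {0..b / 2}"
    then show "x0 + t *\<^sub>R w \<in> U" using b x0 by (cases "t = 0") auto
  qed (use b in auto)
qed

lemma derivative_along_segment:
  assumes \<phi>: "(\<phi> has_derivative A) (at x0 within U)"
    and seg: "\<And>t. t \<in> {0..\<delta>} \<Longrightarrow> x0 + t *\<^sub>R w \<in> U"
  shows "((\<lambda>t. \<phi> (x0 + t *\<^sub>R w)) has_vector_derivative A w) (at 0 within {0..\<delta>})"
proof -
  have A: "bounded_linear A" using \<phi> by (rule has_derivative_bounded_linear)
  have "((\<lambda>t. x0 + t *\<^sub>R w) has_derivative (\<lambda>t. t *\<^sub>R w)) (at 0 within {0..\<delta>})"
    by (auto intro!: derivative_eq_intros)
  moreover have "(\<phi> has_derivative A) (at (x0 + 0 *\<^sub>R w) within (\<lambda>t. x0 + t *\<^sub>R w) ` {0..\<delta>})"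
    using has_derivative_subset[OF \<phi>] seg by (simp add: image_subset_iff)
  ultimately have "((\<lambda>t. \<phi> (x0 + t *\<^sub>R w)) has_derivative (\<lambda>t. A (t *\<^sub>R w))) (at 0 within {0..\<delta>})"
    by (rule has_derivative_in_compose)
  then show ?thesis
    by (simp add: has_vector_derivative_def linear_scale[OF bounded_linear.linear[OF A]])
qed

text \<open>The target slack along the image of the segment is nonnegative and starts at 0, so its
  right derivative is nonnegative. Applied to a chart and to its inverse, this makes the derivatives
  map tangent cones into tangent cones.\<close>

lemma derivative_preserves_active_constraint:
  assumes U: "openin (top_of_set region) U" and x0: "x0 \<in> U" and w: "w \<in> tangent x0"
    and \<phi>: "(\<phi> has_derivative A) (at x0 within U)" and L: "bounded_linear L"
    and nonneg: "\<And>x. x \<in> U \<Longrightarrow> 0 \<le> b + L (\<phi> x)" and active: "b + L (\<phi> x0) = (0::real)"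
  shows "0 \<le> L (A w)"
proof -
  obtain \<delta> where \<delta>: "\<delta> > 0" "\<And>t. t \<in> {0..\<delta>} \<Longrightarrow> x0 + t *\<^sub>R w \<in> U"
    using tangent_segment[OF U x0 w] by blast
  have "((\<lambda>t. L (\<phi> (x0 + t *\<^sub>R w))) has_vector_derivative L (A w)) (at 0 within {0..\<delta>})"
    by (rule bounded_linear.has_vector_derivative[OF L derivative_along_segment[OF \<phi> \<delta>(2)]])
  then have "((\<lambda>t. (L (\<phi> (x0 + t *\<^sub>R w)) - L (\<phi> x0)) / t) \<longlongrightarrow> L (A w)) (at 0 within {0..\<delta>})"
    by (simp add: has_field_derivative_iff flip: has_real_derivative_iff_has_vector_derivative)
  then have lim: "((\<lambda>t. (L (\<phi> (x0 + t *\<^sub>R w)) - L (\<phi> x0)) / t) \<longlongrightarrow> L (A w)) (at_right 0)"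
    using \<delta>(1) by (simp add: at_within_Icc_at_right)
  have "\<forall>\<^sub>F t in at_right 0. 0 < t \<and> t < \<delta>"
    using \<delta>(1) by (auto simp: eventually_at_right_field)
  then have "\<forall>\<^sub>F t in at_right 0. 0 \<le> (L (\<phi> (x0 + t *\<^sub>R w)) - L (\<phi> x0)) / t"
  proof (rule eventually_mono)
    fix t assume t: "0 < t \<and> t < \<delta>"
    then have "0 \<le> L (\<phi> (x0 + t *\<^sub>R w)) - L (\<phi> x0)"
      using nonneg[OF \<delta>(2)[of t]] active by auto
    with t show "0 \<le> (L (\<phi> (x0 + t *\<^sub>R w)) - L (\<phi> x0)) / t" by simp
  qed
  then show ?thesis
    by (rule tendsto_lowerbound[OF lim]) simp
qed

text \<open>The composition is the identity along the segment in direction \<open>w\<close>, whose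
  one-sided derivative is unique. Only tangent directions provide such a segment, whence the
  hypothesis on \<open>w\<close>.\<close>

lemma derivative_left_inverse:
  assumes U: "openin (top_of_set region) U" and x0: "x0 \<in> U" and w: "w \<in> tangent x0"
    and \<phi>: "(\<phi> has_derivative A) (at x0 within U)"
    and \<psi>: "(\<psi> has_derivative B) (at (\<phi> x0) within V)"
    and V: "\<phi> ` U \<subseteq> V" and inv: "\<And>x. x \<in> U \<Longrightarrow> \<psi> (\<phi> x) = x"
  shows "B (A w) = w"
proof -
  obtain \<delta> where \<delta>: "\<delta> > 0" "\<And>t. t \<in> {0..\<delta>} \<Longrightarrow> x0 + t *\<^sub>R w \<in> U"
    using tangent_segment[OF U x0 w] by blast
  have "((\<lambda>x. \<psi> (\<phi> x)) has_derivative (\<lambda>x. B (A x))) (at x0 within U)"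
    by (rule has_derivative_in_compose[OF \<phi> has_derivative_subset[OF \<psi> V]])
  then have "((\<lambda>x. x) has_derivative (\<lambda>x. B (A x))) (at x0 within U)"
    by (rule has_derivative_transform[OF x0, rotated]) (simp add: inv)
  then have 1: "((\<lambda>t. x0 + t *\<^sub>R w) has_vector_derivative B (A w)) (at 0 within {0..\<delta>})"
    by (rule derivative_along_segment[OF _ \<delta>(2)])
  have 2: "((\<lambda>t. x0 + t *\<^sub>R w) has_vector_derivative w) (at 0 within {0..\<delta>})"
    by (auto intro!: derivative_eq_intros)
  show ?thesis
    by (rule vector_derivative_unique_within_closed_interval[OF _ _ 1[folded cbox_interval] 2[folded cbox_interval]]) (use \<delta>(1) in auto)
qed

end

section \<open>Facets at a vertex\<close>

lemma facet_functionals: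
  fixes M :: "'a::euclidean_space set"
  assumes "polytope M"
  obtains a b where "\<And>F x. F facet_of M \<Longrightarrow> x \<in> M \<Longrightarrow> a F \<bullet> x \<le> b F"
    "\<And>F. F facet_of M \<Longrightarrow> F = M \<inter> {x. a F \<bullet> x = b F}"
proof -
  have "\<forall>F. \<exists>a b. F facet_of M \<longrightarrow> M \<subseteq> {x. a \<bullet> x \<le> b} \<and> F = M \<inter> {x. a \<bullet> x = b}"
    by (metis facet_of_polyhedron polytope_imp_polyhedron[OF assms])
  then obtain a b where ab: "\<And>F. F facet_of M \<longrightarrow> M \<subseteq> {x. a F \<bullet> x \<le> b F} \<and> F = M \<inter> {x. a F \<bullet> x = b F}"
    by metis
  show thesis
  proof (rule that)
    show "a F \<bullet> x \<le> b F" if "F facet_of M" "x \<in> M" for F x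
      using ab[of F] that by auto
    show "F = M \<inter> {x. a F \<bullet> x = b F}" if "F facet_of M" for F
      using ab[of F] that by simp
  qed
qed

lemma exists_vertex_in_all_facets_through:
  fixes M :: "'a::euclidean_space set"
  assumes M: "polytope M" and x: "x \<in> M"
  obtains m where "{m} face_of M" "\<And>F. F facet_of M \<Longrightarrow> x \<in> F \<Longrightarrow> m \<in> F"
proof -
  \<comment> \<open>\<open>M\<close> joins the family because a relative interior point lies on no
    facet; the intersection is then a face of \<open>M\<close> in every case.\<close>
  let ?H = "\<Inter> (insert M {F. F facet_of M \<and> x \<in> F})"
  have H: "?H face_of M"
    by (rule face_of_Inter)
      (auto simp: facet_of_def face_of_refl polytope_imp_convex M)
  have "x \<in> ?H" using x by auto
  moreover have "polytope ?H"
    by (rule face_of_polytope_polytope[OF M H])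
  ultimately obtain m where "m extreme_point_of ?H"
    using extreme_point_exists_convex[OF polytope_imp_compact polytope_imp_convex] by blast
  then have m: "{m} face_of ?H" by (simp add: face_of_singleton)
  show thesis
  proof (rule that)
    show "{m} face_of M" by (rule face_of_trans[OF m H])
    show "m \<in> F" if "F facet_of M" "x \<in> F" for F
      using face_of_imp_subset[OF m] that by auto
  qed
qed

section \<open>Facet inequalities and the facet normals at a vertex\<close>

locale polytope_facets =
  fixes M :: "'a::euclidean_space set" and a :: "'a set \<Rightarrow> 'a" and b :: "'a set \<Rightarrow> real"
  assumes M: "polytope M" "M \<noteq> {}"
    and facet_le: "\<And>F x. F facet_of M \<Longrightarrow> x \<in> M \<Longrightarrow> a F \<bullet> x \<le> b F"
    and facet_eq: "\<And>F. F facet_of M \<Longrightarrow> F = M \<inter> {x. a F \<bullet> x = b F}"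
begin

lemma finite_facets: "finite {F. F facet_of M}"
  by (rule finite_polytope_facets[OF M(1)])

lemma mem_facet_iff: "F facet_of M \<Longrightarrow> x \<in> F \<longleftrightarrow> x \<in> M \<and> a F \<bullet> x = b F"
  using facet_eq[of F] by blast

lemma rel_interior_facet_less:
  assumes "z \<in> rel_interior M" "F facet_of M"
  shows "a F \<bullet> z < b F"
proof -
  have "F face_of M" "F \<noteq> M" using assms by (auto simp: facet_of_def)
  then have "z \<notin> F" using face_of_disjoint_rel_interior assms by blast
  moreover have "z \<in> M" using assms rel_interior_subset by blast
  ultimately show ?thesis
    using facet_le[OF assms(2)] mem_facet_iff[OF assms(2)] by fastforce
qed

text \<open>If the ray from a relative interior point \<open>z\<close> to \<open>x\<close> left
  \<open>M\<close> before reaching \<open>x\<close>, it would do so on some facet. The slack of that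
  facet is positive at \<open>z\<close> and nonnegative at \<open>x\<close>, hence positive strictly
  between them, a contradiction.\<close>

lemma mem_iff_facets: "x \<in> M \<longleftrightarrow> x \<in> affine hull M \<and> (\<forall>F. F facet_of M \<longrightarrow> a F \<bullet> x \<le> b F)"
proof
  assume "x \<in> M"
  then show "x \<in> affine hull M \<and> (\<forall>F. F facet_of M \<longrightarrow> a F \<bullet> x \<le> b F)"
    by (simp add: facet_le hull_inc)
next
  assume x: "x \<in> affine hull M \<and> (\<forall>F. F facet_of M \<longrightarrow> a F \<bullet> x \<le> b F)"
  obtain z where z: "z \<in> rel_interior M"
    using M rel_interior_eq_empty polytope_imp_convex by blast
  have zM: "z \<in> M" using z rel_interior_subset by blast
  show "x \<in> M"
  proof (cases "x = z")
    case False
    have "z + (x - z) \<in> affine hull M" "x - z \<noteq> 0" using x False by auto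
    then obtain d where d: "0 < d" "z + d *\<^sub>R (x - z) \<in> rel_frontier M"
      "\<And>e. 0 \<le> e \<Longrightarrow> e < d \<Longrightarrow> z + e *\<^sub>R (x - z) \<in> rel_interior M"
      using ray_to_rel_frontier[OF polytope_imp_bounded[OF M(1)] z] by metis
    have "\<not> d < 1"
    proof
      assume "d < 1"
      obtain F where F: "F facet_of M" "z + d *\<^sub>R (x - z) \<in> F"
        using d(2) rel_frontier_of_polyhedron[OF polytope_imp_polyhedron[OF M(1)]] by blast
      then have "a F \<bullet> (z + d *\<^sub>R (x - z)) = b F" by (simp add: mem_facet_iff)
      then have "(1 - d) * (a F \<bullet> z) + d * (a F \<bullet> x) = b F"
        by (simp add: algebra_simps)
      moreover have "(1 - d) * (a F \<bullet> z) < (1 - d) * b F"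
        using \<open>d < 1\<close> rel_interior_facet_less[OF z F(1)] by simp
      moreover have "d * (a F \<bullet> x) \<le> d * b F"
        using x F d by simp
      ultimately show False by (simp add: algebra_simps)
    qed
    then consider "d = 1" | "1 < d" by linarith
    then show ?thesis
    proof cases
      case 1
      then have "x \<in> rel_frontier M" using d by simp
      then show ?thesis
        using closure_closed[OF polytope_imp_closed[OF M(1)]] by (auto simp: rel_frontier_def)
    next
      case 2
      then show ?thesis using d(3)[of 1] rel_interior_subset by auto
    qed
  qed (use zM in simp)
qed

text \<open>Facets through \<open>m\<close> keep slack 0 along the line in direction
  \<open>w\<close>; the others have positive slack at \<open>m\<close> and tolerate a short move
  both ways. So \<open>M\<close> contains a segment with midpoint \<open>m\<close>, which for
  nonzero \<open>w\<close> is impossible at a vertex.\<close>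

lemma vertex_facet_normals_separate:
  assumes m: "{m} face_of M" and w: "m + w \<in> affine hull M"
    and 0: "\<And>F. F facet_of M \<Longrightarrow> m \<in> F \<Longrightarrow> a F \<bullet> w = 0"
  shows "w = 0"
proof -
  have mM: "m \<in> M" using face_of_imp_subset[OF m] by simp
  have "\<forall>\<^sub>F t in nhds 0. \<bar>t\<bar> * \<bar>a F \<bullet> w\<bar> \<le> b F - a F \<bullet> m" if F: "F facet_of M" for F
  proof (cases "m \<in> F")
    case True
    then show ?thesis using 0[OF F] F by (simp add: mem_facet_iff)
  next
    case False
    then have "0 < b F - a F \<bullet> m"
      using F mM facet_le[OF F mM] by (auto simp: mem_facet_iff)
    moreover have lim: "((\<lambda>t. \<bar>t\<bar> * \<bar>a F \<bullet> w\<bar>) \<longlongrightarrow> \<bar>0\<bar> * \<bar>a F \<bullet> w\<bar>) (nhds 0)"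
      by (intro tendsto_intros filterlim_ident)
    ultimately have "\<forall>\<^sub>F t in nhds 0. \<bar>t\<bar> * \<bar>a F \<bullet> w\<bar> < b F - a F \<bullet> m"
      using order_tendstoD(2)[OF lim] by simp
    then show ?thesis by (rule eventually_mono) simp
  qed
  then have "\<forall>\<^sub>F t in nhds 0. \<forall>F\<in>{F. F facet_of M}. \<bar>t\<bar> * \<bar>a F \<bullet> w\<bar> \<le> b F - a F \<bullet> m"
    by (intro eventually_ball_finite finite_facets) auto
  then obtain \<delta> where \<delta>: "\<delta> > 0" "\<And>t. \<bar>t\<bar> < \<delta> \<Longrightarrow> \<forall>F\<in>{F. F facet_of M}. \<bar>t\<bar> * \<bar>a F \<bullet> w\<bar> \<le> b F - a F \<bullet> m"
    unfolding eventually_nhds_metric by (auto simp: dist_real_def)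
  have in_M: "m + t *\<^sub>R w \<in> M" if "\<bar>t\<bar> < \<delta>" for t
  proof -
    have "m + t *\<^sub>R w = (1 - t) *\<^sub>R m + t *\<^sub>R (m + w)" by (simp add: algebra_simps)
    also have "\<dots> \<in> affine hull M"
      by (intro mem_affine[OF affine_affine_hull] hull_inc mM w) auto
    finally have "m + t *\<^sub>R w \<in> affine hull M" .
    moreover have "a F \<bullet> (m + t *\<^sub>R w) \<le> b F" if "F facet_of M" for F
    proof -
      have "t * (a F \<bullet> w) \<le> \<bar>t\<bar> * \<bar>a F \<bullet> w\<bar>" by (metis abs_ge_self abs_mult)
      then show ?thesis using \<delta>(2)[OF \<open>\<bar>t\<bar> < \<delta>\<close>] that by (force simp: inner_add_right)
    qed
    ultimately show ?thesis by (simp add: mem_iff_facets)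
  qed
  show ?thesis
  proof (rule ccontr)
    assume "w \<noteq> 0"
    let ?t = "\<delta> / 2"
    have "m \<in> open_segment (m + ?t *\<^sub>R w) (m + (- ?t) *\<^sub>R w)"
      unfolding in_segment
    proof (intro conjI exI[of _ "1/2"])
      show "m + ?t *\<^sub>R w \<noteq> m + (- ?t) *\<^sub>R w"
        using \<open>w \<noteq> 0\<close> \<delta>(1) by (simp add: eq_neg_iff_add_eq_0 flip: scaleR_left_distrib)
      show "m = (1 - 1 / 2) *\<^sub>R (m + ?t *\<^sub>R w) + (1 / 2) *\<^sub>R (m + (- ?t) *\<^sub>R w)"
        by (simp add: algebra_simps flip: scaleR_left_distrib)
    qed auto
    moreover have "m + ?t *\<^sub>R w \<in> M" "m + (- ?t) *\<^sub>R w \<in> M"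
      using in_M[of ?t] in_M[of "- ?t"] \<delta>(1) by auto
    ultimately have "m + ?t *\<^sub>R w \<in> {m}"
      using face_ofD[OF m] by blast
    then show False using \<open>w \<noteq> 0\<close> \<delta>(1) by simp
  qed
qed

text \<open>On the n-dimensional direction space the \<open>n\<close> normals have trivial common
  kernel, so they form a basis of the dual and \<open>c\<close> is its dual basis up to sign. The
  sign makes the coordinates equal to the slacks, which are nonnegative on \<open>M\<close>.\<close>

lemma simple_vertex_frame:
  assumes m: "{m} face_of M" and card: "card {F. F facet_of M \<and> m \<in> F} = n"
    and dim: "aff_dim M = int n"
  obtains F c where "bij_betw F {..<n} {F. F facet_of M \<and> m \<in> F}"
    "\<And>i. i < n \<Longrightarrow> m + c i \<in> affine hull M"
    "\<And>i j. i < n \<Longrightarrow> j < n \<Longrightarrow> a (F j) \<bullet> c i = (if i = j then -1 else 0)"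
    "\<And>z. z \<in> affine hull M \<Longrightarrow> z = m + (\<Sum>i<n. (b (F i) - a (F i) \<bullet> z) *\<^sub>R c i)"
proof -
  have mM: "m \<in> M" using face_of_imp_subset[OF m] by simp
  have "finite {F. F facet_of M \<and> m \<in> F}"
    by (rule finite_subset[OF _ finite_facets]) auto
  then obtain F where F: "bij_betw F {..<n} {F. F facet_of M \<and> m \<in> F}"
    using card ex_bij_betw_nat_finite by (metis atLeast0LessThan)
  have Ff: "F i facet_of M" "m \<in> F i" if "i < n" for i
    using bij_betwE[OF F] that by auto
  define S where "S = (\<lambda>x. - m + x) ` (affine hull M)"
  have S_iff: "w \<in> S \<longleftrightarrow> m + w \<in> affine hull M" for w
    by (force simp: S_def)
  have sub: "subspace S"
    unfolding S_def by (rule affine_diffs_subspace) (simp_all add: affine_affine_hull hull_inc mM)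
  have "dim S = n"
    using aff_dim_eq_dim[of m "affine hull M"] dim mM
    by (simp add: S_def hull_hull hull_inc aff_dim_affine_hull)
  then obtain B where B: "B \<subseteq> S" "independent B" "span B = S" "card B = n"
    by (metis basis_subspace_exists sub)
  have "finite B" using B(2) by (rule independent_imp_finite)
  then obtain \<gamma> where \<gamma>: "bij_betw \<gamma> {..<n} B"
    using B(4) ex_bij_betw_nat_finite by (metis atLeast0LessThan)
  have \<gamma>_indep: "\<forall>i<n. t i = 0" if "(\<Sum>i<n. t i *\<^sub>R \<gamma> i) = 0" for t
  proof -
    let ?u = "\<lambda>x. t (inv_into {..<n} \<gamma> x)"
    have inv: "inv_into {..<n} \<gamma> (\<gamma> i) = i" if "i < n" for i
      using \<gamma> that by (simp add: bij_betw_def)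
    have "(\<Sum>x\<in>B. ?u x *\<^sub>R x) = (\<Sum>i<n. ?u (\<gamma> i) *\<^sub>R \<gamma> i)"
      by (rule sum.reindex_bij_betw[OF \<gamma>, symmetric])
    also have "\<dots> = (\<Sum>i<n. t i *\<^sub>R \<gamma> i)" by (intro sum.cong) (auto simp: inv)
    finally have "(\<Sum>x\<in>B. ?u x *\<^sub>R x) = 0" using that by simp
    then have "\<forall>x\<in>B. ?u x = 0"
      using independentD[OF B(2) \<open>finite B\<close> subset_refl, of ?u] by blast
    then show ?thesis using bij_betwE[OF \<gamma>] inv by (metis lessThan_iff)
  qed
  \<comment> \<open>The tuple of values of the normals is encoded as a vector of \<open>S\<close>
    through a basis of \<open>S\<close>. The map becomes an endomorphism of \<open>S\<close>, so
    injectivity yields surjectivity by comparing dimensions.\<close>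
  define \<Lambda> where "\<Lambda> = (\<lambda>w. \<Sum>i<n. (a (F i) \<bullet> w) *\<^sub>R \<gamma> i)"
  have lin: "linear \<Lambda>"
    unfolding \<Lambda>_def
    by (intro linearI) (simp_all add: inner_add_right scaleR_left_distrib sum.distrib scaleR_sum_right)
  have zero: "w = 0" if "w \<in> S" "\<And>i. i < n \<Longrightarrow> a (F i) \<bullet> w = 0" for w
  proof (rule vertex_facet_normals_separate[OF m])
    show "m + w \<in> affine hull M" using that S_iff by simp
    show "a G \<bullet> w = 0" if "G facet_of M" "m \<in> G" for G
    proof -
      have "G \<in> F ` {..<n}" using F that by (auto simp: bij_betw_def)
      then show ?thesis using \<open>\<And>i. i < n \<Longrightarrow> a (F i) \<bullet> w = 0\<close> by auto
    qed
  qed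
  have "inj_on \<Lambda> S"
    unfolding linear_inj_on_iff_eq_0[OF lin sub]
  proof (intro ballI impI)
    fix w assume "w \<in> S" "\<Lambda> w = 0"
    then show "w = 0"
      using zero[of w] \<gamma>_indep[of "\<lambda>i. a (F i) \<bullet> w"] unfolding \<Lambda>_def by simp
  qed
  then have dimL: "dim (\<Lambda> ` S) = dim S"
    by (intro dim_image_eq lin) (simp add: span_eq_iff[THEN iffD2, OF sub])
  have \<gamma>S: "\<gamma> i \<in> S" if "i < n" for i
    using bij_betwE[OF \<gamma>] that B(1) by auto
  have "\<Lambda> ` S \<subseteq> S"
    unfolding \<Lambda>_def by (auto intro!: subspace_sum[OF sub] subspace_scale[OF sub] \<gamma>S)
  then have surj: "\<Lambda> ` S = S"
    by (intro subspace_dim_equal linear_subspace_image lin sub) (simp_all add: dimL)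
  have "\<forall>i. \<exists>c. i < n \<longrightarrow> c \<in> S \<and> \<Lambda> c = - \<gamma> i"
    using surj subspace_neg[OF sub] \<gamma>S by (metis imageE)
  then obtain c where c: "\<And>i. i < n \<Longrightarrow> c i \<in> S" "\<And>i. i < n \<Longrightarrow> \<Lambda> (c i) = - \<gamma> i"
    by metis
  have ac: "a (F j) \<bullet> c i = (if i = j then -1 else 0)" if ij: "i < n" "j < n" for i j
  proof -
    have "(\<Sum>k<n. (a (F k) \<bullet> c i + (if k = i then 1 else 0)) *\<^sub>R \<gamma> k) = \<Lambda> (c i) + (\<Sum>k<n. if k = i then \<gamma> k else 0)"
      unfolding \<Lambda>_def sum.distrib[symmetric] by (intro sum.cong) (auto simp: scaleR_left_distrib)
    also have "\<dots> = 0" using c(2) ij by simp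
    finally have "a (F j) \<bullet> c i + (if j = i then 1 else 0) = 0"
      using \<gamma>_indep[of "\<lambda>k. a (F k) \<bullet> c i + (if k = i then 1 else 0)"] ij by blast
    then show ?thesis by (auto split: if_splits)
  qed
  show thesis
  proof (rule that[OF F _ ac])
    show "m + c i \<in> affine hull M" if "i < n" for i using c(1)[OF that] S_iff by simp
    fix z assume z: "z \<in> affine hull M"
    let ?w' = "\<Sum>i<n. (b (F i) - a (F i) \<bullet> z) *\<^sub>R c i"
    have "z - m - ?w' = 0"
    proof (rule zero)
      show "z - m - ?w' \<in> S"
      proof (rule subspace_diff[OF sub])
        show "z - m \<in> S" using z by (simp add: S_iff)
        show "?w' \<in> S"
          by (intro subspace_sum[OF sub] subspace_scale[OF sub]) (use c(1) in auto)
      qed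
      fix j assume j: "j < n"
      have "a (F j) \<bullet> ?w' = (\<Sum>i<n. if i = j then a (F j) \<bullet> z - b (F j) else 0)"
        unfolding inner_sum_right by (intro sum.cong) (auto simp: ac j)
      moreover have "a (F j) \<bullet> m = b (F j)"
        using Ff[OF j] by (simp add: mem_facet_iff)
      ultimately show "a (F j) \<bullet> (z - m - ?w') = 0"
        using j by (simp add: inner_diff_right)
    qed
    then have "m + (z - m) = m + ?w'" by simp
    then show "z = m + ?w'" by (simp only: add_diff_cancel_left' add_diff_eq)
  qed
qed

end

text \<open>The hypotheses say that near \<open>m\<close> the set is the simplicial cone with apex \<open>m\<close> generated by
  \<open>c 0, \<dots>, c (n - 1)\<close>; the facets at \<open>m\<close> are cut out by the dual functionals.\<close>

lemma card_facets_at_simplicial_vertex: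
  fixes M :: "'a::euclidean_space set"
  assumes conv: "convex M" and dim: "aff_dim M = int n" and m: "m \<in> M"
    and mc: "\<And>i. i < n \<Longrightarrow> m + c i \<in> M"
    and indep: "\<And>t i. (\<Sum>i<n. t i *\<^sub>R c i) = 0 \<Longrightarrow> i < n \<Longrightarrow> t i = 0"
    and cone: "\<And>z. z \<in> M \<Longrightarrow> \<exists>t. (\<forall>i<n. 0 \<le> t i) \<and> z = m + (\<Sum>i<n. t i *\<^sub>R c i)"
  shows "card {F. F facet_of M \<and> m \<in> F} = n"
proof -
  have inj: "inj_on c {..<n}"
  proof (rule inj_onI)
    fix i j assume ij: "i \<in> {..<n}" "j \<in> {..<n}" "c i = c j"
    show "i = j"
    proof (rule ccontr)
      assume "i \<noteq> j"
      let ?t = "\<lambda>k. (if k = i then 1 else 0) - (if k = j then 1 else 0) :: real"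
      have "(\<Sum>k<n. ?t k *\<^sub>R c k) = (\<Sum>k<n. if k = i then c k else 0) - (\<Sum>k<n. if k = j then c k else 0)"
        unfolding sum_subtractf[symmetric] by (intro sum.cong) auto
      also have "\<dots> = 0" using ij by simp
      finally have "?t i = 0" using indep[of ?t i] ij by simp
      then show False using \<open>i \<noteq> j\<close> by simp
    qed
  qed
  have ind: "independent (c ` {..<n})"
  proof (rule independent_if_scalars_zero)
    fix f x assume 0: "(\<Sum>x\<in>c ` {..<n}. f x *\<^sub>R x) = 0" and "x \<in> c ` {..<n}"
    then obtain i where i: "i < n" "x = c i" by auto
    have "(\<Sum>k<n. f (c k) *\<^sub>R c k) = 0" using 0 by (simp add: sum.reindex[OF inj])
    then show "f x = 0" using indep[of "\<lambda>k. f (c k)" i] i by simp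
  qed simp
  \<comment> \<open>Dual vectors: the Kronecker delta on the independent vectors extends to a linear
    functional, and the adjoint represents it by an inner product.\<close>
  have "\<exists>d. \<forall>j<n. d \<bullet> c j = (if j = i then 1 else 0)" for i
  proof -
    let ?h = "\<lambda>x. if inv_into {..<n} c x = i then 1 else (0::real)"
    obtain g where g: "linear g" "\<forall>x\<in>c ` {..<n}. g x = ?h x"
      using linear_independent_extend[OF ind, of ?h] by blast
    have "adjoint g 1 \<bullet> c j = (if j = i then 1 else 0)" if "j < n" for j
    proof -
      have "adjoint g 1 \<bullet> c j = g (c j)"
        using adjoint_works[OF g(1), of "c j" 1] by (simp add: inner_commute)
      then show ?thesis using g(2) that by (simp add: inv_into_f_f[OF inj])
    qed
    then show ?thesis by blast
  qed
  then obtain d where d: "\<And>i j. j < n \<Longrightarrow> d i \<bullet> c j = (if j = i then 1 else 0)"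
    by metis
  have coord: "d i \<bullet> (m + (\<Sum>j<n. t j *\<^sub>R c j)) = d i \<bullet> m + t i" if "i < n" for t i
  proof -
    have "d i \<bullet> (\<Sum>j<n. t j *\<^sub>R c j) = (\<Sum>j<n. if j = i then t i else 0)"
      unfolding inner_sum_right by (intro sum.cong) (auto simp: d)
    then show ?thesis using that by (simp add: inner_add_right)
  qed
  have ge: "d i \<bullet> m \<le> d i \<bullet> z" if "z \<in> M" "i < n" for z i
    using cone[OF that(1)] coord[OF that(2)] that by auto
  \<comment> \<open>The points \<open>m\<close> and \<open>m + c i\<close> for \<open>i\<close> in
    \<open>I\<close> are affinely independent.\<close>
  have dim_ge: "int (card I) \<le> aff_dim S"
    if S: "m \<in> S" "\<And>i. i \<in> I \<Longrightarrow> m + c i \<in> S" and I: "I \<subseteq> {..<n}" for I S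
  proof -
    have "c ` I \<subseteq> (\<lambda>x. - m + x) ` S"
      using S(2) by (force simp: image_iff)
    moreover have "independent (c ` I)"
      using ind I by (meson image_mono independent_mono)
    ultimately have "card (c ` I) \<le> dim ((\<lambda>x. - m + x) ` S)"
      by (rule independent_card_le_dim)
    moreover have "card (c ` I) = card I"
      using card_image inj_on_subset[OF inj I] by blast
    ultimately show ?thesis
      using aff_dim_eq_dim[OF hull_inc[OF S(1)]] by simp
  qed
  define F where "F = (\<lambda>i. M \<inter> {z. d i \<bullet> z = d i \<bullet> m})"
  have F_face: "F i face_of M" if "i < n" for i
    unfolding F_def by (rule face_of_Int_supporting_hyperplane_ge[OF conv]) (use ge that in auto)
  have mF: "m \<in> F i" for i using m by (simp add: F_def)
  have mcF: "m + c j \<in> F i \<longleftrightarrow> j \<noteq> i" if "j < n" for i j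
    using that by (auto simp: F_def mc inner_add_right d)
  have F_facet: "F i facet_of M" if i: "i < n" for i
  proof -
    have "F i \<noteq> M" using mcF[OF i, of i] mc[OF i] by blast
    then have "aff_dim (F i) < int n"
      using face_of_aff_dim_lt[OF conv F_face[OF i]] dim by simp
    moreover have "int (card ({..<n} - {i})) \<le> aff_dim (F i)"
      by (rule dim_ge[OF mF]) (use mcF in auto)
    ultimately show ?thesis
      using F_face[OF i] mF[of i] i dim by (auto simp: facet_of_def)
  qed
  have simplex: "m + (\<Sum>i<n. t i *\<^sub>R c i) \<in> M"
    if t: "\<And>i. i < n \<Longrightarrow> 0 \<le> t i" and le: "(\<Sum>i<n. t i) \<le> 1" for t
  proof -
    \<comment> \<open>Index \<open>n\<close> stands for the apex \<open>m\<close>, which receives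
      the weight left over by the generators.\<close>
    let ?u = "\<lambda>i. if i = n then 1 - (\<Sum>i<n. t i) else t i"
    let ?y = "\<lambda>i. if i = n then m else m + c i"
    have "(\<Sum>i\<in>{..<Suc n}. ?u i *\<^sub>R ?y i) \<in> M"
      by (rule convex_sum[OF _ conv]) (use t le m mc in \<open>auto simp: less_Suc_eq\<close>)
    moreover have "(\<Sum>i\<in>{..<Suc n}. ?u i *\<^sub>R ?y i) = m + (\<Sum>i<n. t i *\<^sub>R c i)"
      by (simp add: scaleR_add_right sum.distrib scaleR_left_diff_distrib flip: scaleR_left.sum)
    ultimately show ?thesis by simp
  qed
  \<comment> \<open>A point of \<open>G\<close> with positive \<open>i\<close>-th coordinate, pulled
    close to \<open>m\<close>, is a proper convex combination of \<open>m + c i\<close> and a point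
    of \<open>M\<close> with \<open>i\<close>-th coordinate 0. The face property then puts
    \<open>m + c i\<close> into \<open>G\<close>.\<close>
  have generator_in_face: "m + c i \<in> G"
    if G: "G face_of M" "m \<in> G" and p: "p \<in> G" "d i \<bullet> p \<noteq> d i \<bullet> m" and i: "i < n" for G p i
  proof -
    have "p \<in> M" using p(1) face_of_imp_subset[OF G(1)] by blast
    then obtain t where t: "\<And>j. j < n \<Longrightarrow> 0 \<le> t j" "p = m + (\<Sum>j<n. t j *\<^sub>R c j)"
      using cone by blast
    have ti: "0 < t i" using t p(2) coord[OF i, of t] i by (metis add.right_neutral order_le_less)
    define T where "T = (\<Sum>j<n. t j)"
    have T: "0 < T" "t i \<le> T"
      unfolding T_def using t(1) i ti by (auto intro!: sum_pos2[of _ i] member_le_sum)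
    \<comment> \<open>With this factor the coordinates of \<open>?p\<close> sum to at most 1/2.
      Hence \<open>r\<close> is at most 1/2, and the remaining coordinates still sum to at most 1
      after division by \<open>1 - r\<close>, so \<open>?y\<close> lies in the simplex inside
      \<open>M\<close>.\<close>
    define s where "s = 1 / (2 * (T + 1))"
    have s: "0 < s" "s \<le> 1" "s * T \<le> 1 / 2" using T by (simp_all add: s_def field_simps)
    define r where "r = s * t i"
    have r: "0 < r" "r \<le> 1 / 2"
      unfolding r_def using s ti order_trans[OF mult_left_mono[OF T(2), of s] s(3)] by simp_all
    define y where "y = (\<lambda>j. (if j = i then 0 else s * t j) / (1 - r))"
    have yM: "m + (\<Sum>j<n. y j *\<^sub>R c j) \<in> M"
    proof (rule simplex)
      show "0 \<le> y j" if "j < n" for j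
        using t(1)[OF that] s r by (simp add: y_def)
      have "(\<Sum>j<n. if j = i then 0 else s * t j) \<le> (\<Sum>j<n. s * t j)"
        using t(1) s by (intro sum_mono) auto
      also have "\<dots> = s * T" by (simp add: T_def sum_distrib_left)
      finally show "(\<Sum>j<n. y j) \<le> 1"
        using r s by (simp add: y_def field_simps flip: sum_divide_distrib)
    qed
    let ?y = "m + (\<Sum>j<n. y j *\<^sub>R c j)"
    let ?p = "m + s *\<^sub>R (p - m)"
    have "(1 - s) *\<^sub>R m + s *\<^sub>R p \<in> G"
      by (rule convexD_alt[OF face_of_imp_convex[OF G(1)] G(2) p(1)]) (use s in auto)
    then have pG: "?p \<in> G" by (simp add: algebra_simps)
    have eq: "?p = (1 - r) *\<^sub>R ?y + r *\<^sub>R (m + c i)"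
    proof -
      have "(\<Sum>j<n. (s * t j) *\<^sub>R c j) = (\<Sum>j<n. (if j = i then 0 else s * t j) *\<^sub>R c j + (if j = i then r *\<^sub>R c i else 0))"
        by (intro sum.cong) (auto simp: r_def)
      also have "\<dots> = (\<Sum>j<n. (if j = i then 0 else s * t j) *\<^sub>R c j) + r *\<^sub>R c i"
        using i by (simp add: sum.distrib)
      also have "(\<Sum>j<n. (if j = i then 0 else s * t j) *\<^sub>R c j) = (1 - r) *\<^sub>R (\<Sum>j<n. y j *\<^sub>R c j)"
        using r by (simp add: y_def scaleR_sum_right)
      finally show ?thesis
        using t(2) by (simp add: scaleR_sum_right algebra_simps)
    qed
    show ?thesis
    proof (cases "?y = m + c i")
      case True
      then have "?p = m + c i" unfolding eq by (simp add: algebra_simps)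
      then show ?thesis using pG by simp
    next
      case False
      then have "?p \<in> open_segment ?y (m + c i)"
        unfolding in_segment using eq r by auto
      then show ?thesis
        using face_ofD[OF G(1) _ yM mc[OF i] pG] by blast
    qed
  qed
  have surj: "G \<in> F ` {..<n}" if G: "G facet_of M" "m \<in> G" for G
  proof -
    have Gf: "G face_of M" and Gd: "aff_dim G = int n - 1"
      using G dim by (auto simp: facet_of_def)
    \<comment> \<open>A facet through \<open>m\<close> contained in no \<open>F i\<close> would
      contain every generator point \<open>m + c i\<close> and thus have dimension at least
      \<open>n\<close>. Once \<open>G\<close> lies in some \<open>F i\<close>, equality of
      dimensions forces \<open>G = F i\<close>.\<close>
    have "\<exists>i<n. G \<subseteq> F i"
    proof (rule ccontr)
      assume no: "\<not> (\<exists>i<n. G \<subseteq> F i)"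
      have "m + c i \<in> G" if i: "i < n" for i
      proof -
        obtain p where p: "p \<in> G" "p \<notin> F i" using no i by blast
        then have "d i \<bullet> p \<noteq> d i \<bullet> m"
          using face_of_imp_subset[OF Gf] by (auto simp: F_def)
        then show ?thesis by (rule generator_in_face[OF Gf G(2) p(1) _ i])
      qed
      then have "int (card {..<n}) \<le> aff_dim G"
        by (intro dim_ge G(2)) auto
      with Gd show False by simp
    qed
    then obtain i where i: "i < n" "G \<subseteq> F i" by blast
    have "G face_of F i"
      by (rule face_of_subset[OF Gf i(2)]) (simp add: F_def)
    moreover have "aff_dim (F i) = int n - 1"
      using F_facet[OF i(1)] dim by (simp add: facet_of_def)
    ultimately have "G = F i"
      using face_of_aff_dim_lt[OF face_of_imp_convex[OF F_face[OF i(1)]]] Gd by fastforce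
    then show ?thesis using i by blast
  qed
  have "inj_on F {..<n}"
  proof (rule inj_onI)
    fix i j assume ij: "i \<in> {..<n}" "j \<in> {..<n}" "F i = F j"
    then have "m + c i \<notin> F j" using mcF[of i i] by auto
    then show "i = j" using mcF[of i j] ij by auto
  qed
  moreover have "{F. F facet_of M \<and> m \<in> F} = F ` {..<n}"
    using surj F_facet mF by auto
  ultimately show ?thesis by (simp add: card_image)
qed

section \<open>Cube-like polytopes are simple\<close>

text \<open>The hypothesis gives only combinations of two points of \<open>Rn n\<close>. Homogeneity
  of the linear part comes from combinations with 0, additivity from the midpoint of
  \<open>2 x\<close> and \<open>2 y\<close>.\<close>

lemma affine_map_on_eq_lincomb:
  fixes f :: "rvec \<Rightarrow> 'b::real_normed_vector"
  assumes f: "affine_map_on (Rn n) f" and "y \<in> Rn n"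
  shows "f y = f 0 + lincomb n (\<lambda>i. f (Poly_Mapping.single i 1) - f 0) y"
proof -
  let ?e = "\<lambda>i. Poly_Mapping.single i (1::real)"
  define g where "g = (\<lambda>y. f y - f 0)"
  have aff: "f ((1 - t) *\<^sub>R x + t *\<^sub>R y) = (1 - t) *\<^sub>R f x + t *\<^sub>R f y"
    if "x \<in> Rn n" "y \<in> Rn n" for x y t
    using f that by (simp add: affine_map_on_def)
  have scale: "g (t *\<^sub>R y) = t *\<^sub>R g y" if "y \<in> Rn n" for t y
    using aff[OF Rn_closed(1) that, of t] by (simp add: g_def algebra_simps)
  have add: "g (x + y) = g x + g y" if xy: "x \<in> Rn n" "y \<in> Rn n" for x y
  proof -
    have R: "2 *\<^sub>R x \<in> Rn n" "2 *\<^sub>R y \<in> Rn n" using xy by (simp_all add: Rn_closed)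
    have "f (x + y) = (1 / 2) *\<^sub>R f (2 *\<^sub>R x) + (1 / 2) *\<^sub>R f (2 *\<^sub>R y)"
      using aff[OF R, of "1 / 2"] by simp
    moreover have "f (2 *\<^sub>R x) = 2 *\<^sub>R g x + f 0" "f (2 *\<^sub>R y) = 2 *\<^sub>R g y + f 0"
      using scale[OF xy(1), of 2] scale[OF xy(2), of 2] by (simp_all add: g_def algebra_simps)
    ultimately have "f (x + y) = g x + g y + ((1 / 2) *\<^sub>R f 0 + (1 / 2) *\<^sub>R f 0)"
      by (simp add: scaleR_add_right)
    then show ?thesis
      by (simp add: g_def flip: scaleR_left_distrib)
  qed
  have "g (\<Sum>i\<in>A. t i *\<^sub>R ?e i) = (\<Sum>i\<in>A. t i *\<^sub>R g (?e i)) \<and> (\<Sum>i\<in>A. t i *\<^sub>R ?e i) \<in> Rn n"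
    if "finite A" "A \<subseteq> {..<n}" for A and t :: "nat \<Rightarrow> real"
    using that
  proof (induction A rule: finite_induct)
    case empty
    then show ?case by (simp add: g_def Rn_closed)
  next
    case (insert j A)
    then show ?case by (simp add: add scale Rn_closed single_in_Rn)
  qed
  from this[of "{..<n}" "Poly_Mapping.lookup y"] have "g y = lincomb n (\<lambda>i. g (?e i)) y"
    using rvec_of_lookup[OF \<open>y \<in> Rn n\<close>] by (simp add: rvec_of_def lincomb_def)
  then show ?thesis by (simp add: g_def algebra_simps)
qed

lemma bounded_linear_inner_lincomb: "bounded_linear (\<lambda>y. a \<bullet> lincomb n c y)"
  for c :: "nat \<Rightarrow> 'a::real_inner"
  by (rule bounded_linear_compose[OF bounded_linear_inner_right bounded_linear_lincomb])

lemma polyhedral_region_orthant: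
  "polyhedral_region n {..<n} (\<lambda>_. 0) (\<lambda>i x. Poly_Mapping.lookup x i) (rvec_of n (\<lambda>_. 1))"
  by (rule polyhedral_region.intro) (simp_all add: bounded_linear_lookup lookup_rvec_of)

lemma cube_like_imp_simple:
  fixes M :: "'a::euclidean_space set"
  assumes "cube_like M"
  shows "simple_polytope M"
proof -
  let ?e = "\<lambda>i. Poly_Mapping.single i (1::real)"
  obtain n f where M: "polytope M" "M \<noteq> {}" and dim: "aff_dim M = int n"
    and f: "affine_map_on (Rn n) f" "inj_on f (Rn n)" "f ` Rn n = affine hull M"
    and cube: "cube_like_Rn n {x \<in> Rn n. f x \<in> M}"
    using assms by (auto simp: cube_like_def)
  define L where "L = lincomb n (\<lambda>i. f (?e i) - f 0)"
  have fL: "f y = f 0 + L y" if "y \<in> Rn n" for y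
    unfolding L_def by (rule affine_map_on_eq_lincomb[OF f(1) that])
  have L: "bounded_linear L" unfolding L_def by (rule bounded_linear_lincomb)
  note lin_L = bounded_linear.linear[OF L]
  have L_zero: "w = 0" if "w \<in> Rn n" "L w = 0" for w
    using inj_onD[OF f(2), of w 0] fL[OF that(1)] that by (simp add: Rn_closed)
  obtain a b where "\<And>F x. F facet_of M \<Longrightarrow> x \<in> M \<Longrightarrow> a F \<bullet> x \<le> b F"
    "\<And>F. F facet_of M \<Longrightarrow> F = M \<inter> {x. a F \<bullet> x = b F}"
    using facet_functionals[OF M(1)] by metis
  then interpret P: polytope_facets M a b
    by (intro polytope_facets.intro M)
  \<comment> \<open>The facet slacks pulled back along \<open>f\<close> turn the preimage of
    \<open>M\<close> into a \<open>polyhedral_region\<close>. A preimage of a relative interior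
    point serves as its witness \<open>q\<close>.\<close>
  define l where "l = (\<lambda>F y. - (a F \<bullet> L y))"
  define \<beta> where "\<beta> = (\<lambda>F. b F - a F \<bullet> f 0)"
  have \<beta>l: "\<beta> F + l F x = b F - a F \<bullet> f x" if "x \<in> Rn n" for F x
    by (simp add: \<beta>_def l_def fL[OF that] inner_add_right)
  obtain z where z: "z \<in> rel_interior M"
    using M rel_interior_eq_empty polytope_imp_convex by blast
  have "z \<in> f ` Rn n"
    unfolding f(3) by (rule hull_inc[OF subsetD[OF rel_interior_subset z]])
  then obtain q where q: "q \<in> Rn n" "f q = z" by blast
  interpret Q: polyhedral_region n "{F. F facet_of M}" \<beta> l q
  proof (rule polyhedral_region.intro)
    show "bounded_linear (l F)" for F
      unfolding l_def L_def by (intro bounded_linear_minus bounded_linear_inner_lincomb)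
    show "0 < \<beta> F + l F q" if "F \<in> {F. F facet_of M}" for F
      using P.rel_interior_facet_less[OF z] that \<beta>l[OF q(1)] q(2) by simp
  qed (fact P.finite_facets q(1))+
  interpret O: polyhedral_region n "{..<n}" "\<lambda>_. 0" "\<lambda>i x. Poly_Mapping.lookup x i" "rvec_of n (\<lambda>_. 1)"
    by (rule polyhedral_region_orthant)
  have fRn: "f x \<in> affine hull M" if "x \<in> Rn n" for x using f(3) that by blast
  have Q: "Q.region = {x \<in> Rn n. f x \<in> M}"
    unfolding Q.region_def by (auto simp: \<beta>l P.mem_iff_facets fRn)
  have O: "O.region = orthant n"
    by (auto simp: O.region_def orthant_def)
  have "card {F. F facet_of M \<and> m \<in> F} = n" if m: "{m} face_of M" for m
  proof -
    have mM: "m \<in> M" using face_of_imp_subset[OF m] by simp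
    have "m \<in> f ` Rn n" unfolding f(3) by (rule hull_inc[OF mM])
    then obtain x0 where x0: "x0 \<in> Rn n" "f x0 = m" by blast
    then have "x0 \<in> {x \<in> Rn n. f x \<in> M}" using mM by simp
    then obtain U V \<phi> where U: "x0 \<in> U" "openin (top_of_set Q.region) U"
      and V: "openin (top_of_set O.region) V" and "smooth_diffeo n U V \<phi>"
      using cube unfolding cube_like_Rn_def Q O by meson
    define \<psi> where "\<psi> = inv_into U \<phi>"
    define y0 where "y0 = \<phi> x0"
    have \<phi>: "bij_betw \<phi> U V" "smooth_map n n U \<phi>" and \<psi>: "smooth_map n n V \<psi>"
      using \<open>smooth_diffeo n U V \<phi>\<close> by (auto simp: smooth_diffeo_def \<psi>_def)
    have \<psi>\<phi>: "\<psi> (\<phi> x) = x" if "x \<in> U" for x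
      unfolding \<psi>_def using \<phi>(1) that by (simp add: bij_betw_def)
    have \<phi>\<psi>: "\<phi> (\<psi> y) = y" if "y \<in> V" for y
      unfolding \<psi>_def using \<phi>(1) that by (simp add: bij_betw_def f_inv_into_f)
    have y0: "y0 \<in> V" unfolding y0_def using \<phi>(1) U(1) by (auto dest: bij_betwE)
    have \<psi>y0: "\<psi> y0 = x0" unfolding y0_def by (rule \<psi>\<phi>[OF U(1)])
    have \<phi>V: "\<phi> ` U \<subseteq> V" using \<phi>(1) by (simp add: bij_betw_def)
    have \<psi>U: "\<psi> ` V \<subseteq> U" using \<phi>V \<phi>(1) \<psi>\<phi> by (auto simp: bij_betw_def)
    obtain A where A: "bounded_linear A" "(\<phi> has_derivative A) (at x0 within U)" "\<And>w. A w \<in> Rn n"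
      using Q.smooth_map_has_derivative[OF U(2,1) \<phi>(2)] by blast
    obtain B where B: "bounded_linear B" "(\<psi> has_derivative B) (at y0 within V)" "\<And>w. B w \<in> Rn n"
      using O.smooth_map_has_derivative[OF V y0 \<psi>] by blast
    note lin_B = bounded_linear.linear[OF B(1)] and lin_A = bounded_linear.linear[OF A(1)]
    have tangent_A: "A w \<in> O.tangent y0" if w: "w \<in> Q.tangent x0" for w
    proof -
      have "0 \<le> Poly_Mapping.lookup (A w) i" if "i < n" "Poly_Mapping.lookup y0 i = 0" for i
      proof (rule Q.derivative_preserves_active_constraint[OF U(2,1) w A(2) bounded_linear_lookup, of 0])
        show "0 \<le> 0 + Poly_Mapping.lookup (\<phi> x) i" if "x \<in> U" for x
        proof -
          have "\<phi> x \<in> O.region" using \<phi>V openin_imp_subset[OF V] that by blast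
          then show ?thesis using \<open>i < n\<close> by (simp add: O.region_def)
        qed
      qed (use that in \<open>simp add: y0_def\<close>)
      then show ?thesis using A(3) by (simp add: O.tangent_def)
    qed
    have tangent_B: "B u \<in> Q.tangent x0" if u: "u \<in> O.tangent y0" for u
    proof -
      have "0 \<le> l F (B u)" if F: "F facet_of M" "\<beta> F + l F x0 = 0" for F
      proof (rule O.derivative_preserves_active_constraint[OF V y0 u B(2), of "l F" "\<beta> F"])
        show "bounded_linear (l F)" using Q.l F by simp
        show "0 \<le> \<beta> F + l F (\<psi> y)" if "y \<in> V" for y
        proof -
          have "\<psi> y \<in> Q.region" using \<psi>U openin_imp_subset[OF U(2)] that by blast
          then show ?thesis using F by (simp add: Q.region_def)
        qed
      qed (use F \<psi>y0 in simp)
      then show ?thesis using B(3) by (simp add: Q.tangent_def)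
    qed
    have BA: "B (A w) = w" if "w \<in> Q.tangent x0" for w
      by (rule Q.derivative_left_inverse[OF U(2,1) that A(2) B(2)[unfolded y0_def] \<phi>V \<psi>\<phi>])
    have AB: "A (B u) = u" if "u \<in> O.tangent y0" for u
      by (rule O.derivative_left_inverse[OF V y0 that B(2) A(2)[folded \<psi>y0] \<psi>U \<phi>\<psi>])
    have m_add: "f (x0 + w) = m + L w" if "w \<in> Rn n" for w
      using fL[OF x0(1)] fL[of "x0 + w"] x0 that by (simp add: Rn_closed linear_add[OF lin_L])
    text \<open>A coordinate that does not vanish would put a line into the tangent cone at a vertex.\<close>
    have y0_zero: "Poly_Mapping.lookup y0 i = 0" if i: "i < n" for i
    proof (rule ccontr)
      assume nz: "Poly_Mapping.lookup y0 i \<noteq> 0"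
      have t: "?e i \<in> O.tangent y0" "- ?e i \<in> O.tangent y0"
        using i nz by (auto simp: O.tangent_def single_in_Rn Rn_closed lookup_single when_def)
      \<comment> \<open>\<open>B\<close> sends both \<open>?e i\<close> and its negative to tangent
        directions, so every facet slack active at the vertex has slope 0 along the image.\<close>
      have "L (B (?e i)) = 0"
      proof (rule P.vertex_facet_normals_separate[OF m])
        show "m + L (B (?e i)) \<in> affine hull M"
          using fRn[of "x0 + B (?e i)"] m_add B(3) x0(1) by (simp add: Rn_closed)
        fix F assume F: "F facet_of M" "m \<in> F"
        then have "\<beta> F + l F x0 = 0"
          using \<beta>l[OF x0(1)] x0(2) by (simp add: P.mem_facet_iff)
        then have "0 \<le> l F (B (?e i))" "0 \<le> l F (B (- ?e i))"
          using tangent_B[OF t(1)] tangent_B[OF t(2)] F by (auto simp: Q.tangent_def)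
        then show "a F \<bullet> L (B (?e i)) = 0"
          by (simp add: l_def linear_neg[OF lin_B] linear_neg[OF lin_L])
      qed
      then have "B (?e i) = 0" by (rule L_zero[OF B(3)])
      then have "?e i = 0" using AB[OF t(1)] linear_0[OF lin_A] by simp
      then show False by (metis lookup_single_eq lookup_zero zero_neq_one)
    qed
    have tangent_O: "O.tangent y0 = orthant n"
      by (auto simp: O.tangent_def orthant_def y0_zero)
    \<comment> \<open>The identity is known on the orthant, and every vector of \<open>Rn n\<close>
      is the difference of its positive and negative parts.\<close>
    have AB': "A (B u) = u" if u: "u \<in> Rn n" for u
    proof -
      let ?p = "rvec_of n (\<lambda>i. max 0 (Poly_Mapping.lookup u i))"
      let ?p' = "rvec_of n (\<lambda>i. max 0 (- Poly_Mapping.lookup u i))"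
      have "u = ?p - ?p'"
        by (rule Rn_eqI[OF u]) (auto simp: Rn_closed lookup_minus lookup_rvec_of)
      moreover have "?p \<in> O.tangent y0" "?p' \<in> O.tangent y0"
        by (auto simp: tangent_O orthant_def lookup_rvec_of)
      ultimately show ?thesis
        using AB linear_diff[OF lin_A] linear_diff[OF lin_B] by metis
    qed
    \<comment> \<open>The counting lemma wants the points \<open>m + c i\<close> inside
      \<open>M\<close>, whereas a tangent direction stays in \<open>M\<close> only for a short time.
      The generators are therefore rescaled by \<open>\<delta> i\<close>, and coordinates are
      divided by it below.\<close>
    have "\<exists>\<delta>>0. m + \<delta> *\<^sub>R L (B (?e i)) \<in> M" if i: "i < n" for i
    proof -
      have "?e i \<in> O.tangent y0"
        using i by (auto simp: tangent_O orthant_def single_in_Rn lookup_single when_def)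
      then have "B (?e i) \<in> Q.tangent x0" by (rule tangent_B)
      moreover have "x0 \<in> Q.region" using x0 mM by (simp add: Q)
      ultimately obtain \<delta> where \<delta>: "\<delta> > 0" "\<And>t. t \<in> {0..\<delta>} \<Longrightarrow> x0 + t *\<^sub>R B (?e i) \<in> Q.region"
        using Q.tangent_segment[OF openin_subtopology_self] by metis
      then have "f (x0 + \<delta> *\<^sub>R B (?e i)) \<in> M" using \<delta>(2)[of \<delta>] by (simp add: Q)
      then show ?thesis
        using m_add[of "\<delta> *\<^sub>R B (?e i)"] B(3) \<delta>(1) by (auto simp: Rn_closed linear_scale[OF lin_L])
    qed
    then obtain \<delta> where \<delta>: "\<And>i. i < n \<Longrightarrow> \<delta> i > 0"
      "\<And>i. i < n \<Longrightarrow> m + \<delta> i *\<^sub>R L (B (?e i)) \<in> M" by metis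
    have LB: "L (B u) = (\<Sum>i<n. Poly_Mapping.lookup u i *\<^sub>R L (B (?e i)))" if "u \<in> Rn n" for u
      using linear_eq_lincomb[OF linear_compose[OF lin_B lin_L] that] by (simp add: lincomb_def)
    show ?thesis
    proof (rule card_facets_at_simplicial_vertex[OF polytope_imp_convex[OF M(1)] dim mM \<delta>(2)])
      fix t :: "nat \<Rightarrow> real" and i
      assume 0: "(\<Sum>i<n. t i *\<^sub>R \<delta> i *\<^sub>R L (B (?e i))) = 0" and i: "i < n"
      let ?u = "rvec_of n (\<lambda>i. t i * \<delta> i)"
      have "L (B ?u) = 0" using 0 by (simp add: LB lookup_rvec_of)
      then have "B ?u = 0" by (rule L_zero[OF B(3)])
      then have "?u = 0" using AB'[of ?u] linear_0[OF lin_A] by simp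
      then have "Poly_Mapping.lookup ?u i = 0" by simp
      then show "t i = 0" using \<delta>(1)[OF i] i by (simp add: lookup_rvec_of)
    next
      fix z assume z: "z \<in> M"
      have "z \<in> f ` Rn n" unfolding f(3) by (rule hull_inc[OF z])
      then obtain x where x: "x \<in> Rn n" "f x = z" by blast
      define w where "w = x - x0"
      have wR: "w \<in> Rn n" using x x0 by (simp add: w_def Rn_closed)
      \<comment> \<open>A slack that vanishes at \<open>x0\<close> takes the value
        \<open>l F w\<close> at \<open>x\<close>, and \<open>x\<close> satisfies all constraints. So
        all of \<open>M\<close> lies in the cone at \<open>m\<close>.\<close>
      have "w \<in> Q.tangent x0"
      proof -
        have "0 \<le> l F w" if F: "F facet_of M" "\<beta> F + l F x0 = 0" for F
        proof -
          have "x \<in> Q.region" using x z by (simp add: Q)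
          then have "0 \<le> \<beta> F + l F x" using F by (simp add: Q.region_def)
          then show ?thesis using F Q.l_diff[of F x x0] by (simp add: w_def)
        qed
        then show ?thesis using wR by (simp add: Q.tangent_def)
      qed
      then have w: "B (A w) = w" "A w \<in> orthant n"
        using BA tangent_A tangent_O by auto
      let ?t = "\<lambda>i. Poly_Mapping.lookup (A w) i / \<delta> i"
      have "z = m + L w" using m_add[OF wR] x by (simp add: w_def)
      also have "L w = (\<Sum>i<n. Poly_Mapping.lookup (A w) i *\<^sub>R L (B (?e i)))"
        using LB[OF A(3), of w] w(1) by simp
      also have "\<dots> = (\<Sum>i<n. ?t i *\<^sub>R \<delta> i *\<^sub>R L (B (?e i)))"
        using \<delta>(1) by (intro sum.cong) (auto simp: less_imp_neq[symmetric])
      finally have "z = m + (\<Sum>i<n. ?t i *\<^sub>R \<delta> i *\<^sub>R L (B (?e i)))" .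
      moreover have "\<forall>i<n. 0 \<le> ?t i"
        using w(2) \<delta>(1) by (auto simp: orthant_def intro!: divide_nonneg_pos)
      ultimately show "\<exists>t. (\<forall>i<n. 0 \<le> t i) \<and> z = m + (\<Sum>i<n. t i *\<^sub>R \<delta> i *\<^sub>R L (B (?e i)))"
        by (intro exI[of _ ?t]) simp
    qed
  qed
  then show ?thesis
    using M dim by (simp add: simple_polytope_def)
qed

section \<open>Simple polytopes are cube-like\<close>

lemma affine_add_sum:
  assumes A: "affine A" "m \<in> A" and c: "\<And>i. i \<in> I \<Longrightarrow> m + c i \<in> A"
  shows "m + (\<Sum>i\<in>I. t i *\<^sub>R c i) \<in> A"
proof -
  define S where "S = (\<lambda>x. - m + x) ` A"
  have S: "subspace S" unfolding S_def by (rule affine_diffs_subspace[OF A])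
  have mem: "w \<in> S \<longleftrightarrow> m + w \<in> A" for w by (force simp: S_def)
  have "(\<Sum>i\<in>I. t i *\<^sub>R c i) \<in> S"
    by (intro subspace_sum[OF S] subspace_scale[OF S]) (simp add: mem c)
  then show ?thesis by (simp add: mem)
qed

text \<open>Orthonormality makes the coordinates inner products, which gives the parametrization of
  the affine hull an explicit affine inverse.\<close>

lemma affine_hull_orthonormal_frame:
  fixes M :: "'a::euclidean_space set"
  assumes p: "p \<in> M" and dim: "aff_dim M = int n"
  obtains c where "\<And>i. i < n \<Longrightarrow> p + c i \<in> affine hull M"
    "\<And>i j. i < n \<Longrightarrow> j < n \<Longrightarrow> c i \<bullet> c j = (if i = j then 1 else 0)"
    "\<And>z. z \<in> affine hull M \<Longrightarrow> z = p + (\<Sum>i<n. (c i \<bullet> (z - p)) *\<^sub>R c i)"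
proof -
  define S where "S = (\<lambda>x. - p + x) ` (affine hull M)"
  have S_iff: "w \<in> S \<longleftrightarrow> p + w \<in> affine hull M" for w
    by (force simp: S_def)
  have sub: "subspace S"
    unfolding S_def by (rule affine_diffs_subspace) (simp_all add: affine_affine_hull hull_inc p)
  have "dim S = n"
    using aff_dim_eq_dim[of p "affine hull M"] dim p
    by (simp add: S_def hull_hull hull_inc aff_dim_affine_hull)
  then obtain B where B: "B \<subseteq> S" "pairwise orthogonal B" "\<And>x. x \<in> B \<Longrightarrow> norm x = 1"
      "independent B" "card B = n" "span B = S"
    using orthonormal_basis_subspace[OF sub] by metis
  have fin: "finite B" using B(4) by (rule independent_imp_finite)
  then obtain c where c: "bij_betw c {..<n} B"
    using B(5) ex_bij_betw_nat_finite by (metis atLeast0LessThan)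
  have cB: "c i \<in> B" if "i < n" for i using bij_betwE[OF c] that by auto
  show thesis
  proof (rule that)
    show "p + c i \<in> affine hull M" if "i < n" for i
      using cB[OF that] B(1) S_iff by blast
    show "c i \<bullet> c j = (if i = j then 1 else 0)" if ij: "i < n" "j < n" for i j
    proof (cases "i = j")
      case True
      then show ?thesis using B(3)[OF cB[OF ij(1)]] by (simp add: dot_square_norm)
    next
      case False
      then have "c i \<noteq> c j" using c ij by (auto simp: bij_betw_def inj_on_def)
      then show ?thesis
        using B(2) cB ij False by (auto simp: pairwise_def orthogonal_def)
    qed
    fix z assume "z \<in> affine hull M"
    then have "z - p \<in> span B" by (simp add: B(6) S_iff)
    then have "(\<Sum>x\<in>B. ((z - p) \<bullet> x) *\<^sub>R x) = z - p"
      using B(3) by (intro orthonormal_basis_expand[OF B(2)] fin) auto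
    then have "(\<Sum>i<n. ((z - p) \<bullet> c i) *\<^sub>R c i) = z - p"
      using sum.reindex_bij_betw[OF c, of "\<lambda>x. ((z - p) \<bullet> x) *\<^sub>R x"] by simp
    then show "z = p + (\<Sum>i<n. (c i \<bullet> (z - p)) *\<^sub>R c i)"
      by (simp add: inner_commute)
  qed
qed

lemma openin_strict_constraints:
  fixes \<alpha> :: "'j \<Rightarrow> rvec \<Rightarrow> real"
  assumes "finite J" "\<And>j. j \<in> J \<Longrightarrow> continuous_on UNIV (\<alpha> j)"
  shows "openin (top_of_set X) {x \<in> X. \<forall>j\<in>J. \<alpha> j x < \<gamma> j}"
proof -
  have op: "open (\<Inter>j\<in>J. {x. \<alpha> j x < \<gamma> j})"
    by (intro open_INT assms ballI open_Collect_less continuous_on_const)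
  have eq: "{x \<in> X. \<forall>j\<in>J. \<alpha> j x < \<gamma> j} = X \<inter> (\<Inter>j\<in>J. {x. \<alpha> j x < \<gamma> j})"
    by auto
  show ?thesis unfolding eq by (rule openin_open_Int[OF op])
qed

text \<open>\<open>cube_like\<close> asks about a preimage of \<open>M\<close>, which is not visibly
  a polytope. Seen as the image of \<open>M\<close> under the inverse affine map, it is one.\<close>

lemma full_polytope_affine_image:
  fixes M :: "'a::euclidean_space set"
  assumes M: "polytope M" "M \<noteq> {}" and H: "bounded_linear H"
    and Q: "Q = (\<lambda>x. k + H x) ` M" "Q \<subseteq> Rn n"
    and surj: "Rn n \<subseteq> (\<lambda>x. k + H x) ` (affine hull M)"
  shows "full_polytope n Q"
proof -
  have eq: "Q = (+) k ` H ` M" by (simp add: Q image_image)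
  have "polytope Q"
    unfolding eq polytope_translation_eq by (rule polytope_linear_image[OF bounded_linear.linear[OF H] M(1)])
  have "affine hull Q = (\<lambda>x. k + x) ` H ` (affine hull M)"
    unfolding eq affine_hull_translation affine_hull_linear_image[OF H] ..
  then have "Rn n \<subseteq> affine hull Q"
    using surj by (simp add: image_image)
  moreover have "affine hull Q \<subseteq> Rn n"
    by (rule hull_minimal[OF Q(2)]) (rule subspace_imp_affine[OF subspace_Rn])
  ultimately have hull: "affine hull Q = Rn n" by blast
  have "{x - y |x y. x \<in> Rn n \<and> y \<in> Rn n} = Rn n"
  proof (intro equalityI subsetI)
    fix x assume "x \<in> Rn n"
    then have "x = x - 0 \<and> x \<in> Rn n \<and> 0 \<in> Rn n" by (simp add: Rn_closed)
    then show "x \<in> {x - y |x y. x \<in> Rn n \<and> y \<in> Rn n}" by blast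
  qed (auto simp: Rn_closed)
  then have "dim {x - y |x y. x \<in> affine hull Q \<and> y \<in> affine hull Q} = n"
    by (simp only: hull dim_Rn)
  then show ?thesis
    using \<open>polytope Q\<close> M Q by (simp add: full_polytope_def)
qed

lemma simple_imp_cube_like:
  fixes M :: "'a::euclidean_space set"
  assumes "simple_polytope M"
  shows "cube_like M"
proof -
  have M: "polytope M" "M \<noteq> {}"
    and simple: "\<And>m. {m} face_of M \<Longrightarrow> int (card {F. F facet_of M \<and> m \<in> F}) = aff_dim M"
    using assms by (auto simp: simple_polytope_def)
  obtain p where p: "p \<in> M" using M by blast
  define n where "n = nat (aff_dim M)"
  have dim: "aff_dim M = int n"
    unfolding n_def using M(2) by (metis aff_dim_negative_iff not_less nat_0_le)
  obtain c where pc: "\<And>i. i < n \<Longrightarrow> p + c i \<in> affine hull M"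
    and cc: "\<And>i j. i < n \<Longrightarrow> j < n \<Longrightarrow> c i \<bullet> c j = (if i = j then 1 else 0)"
    and expand: "\<And>z. z \<in> affine hull M \<Longrightarrow> z = p + (\<Sum>i<n. (c i \<bullet> (z - p)) *\<^sub>R c i)"
    using affine_hull_orthonormal_frame[OF p dim] by blast
  \<comment> \<open>\<open>f\<close> parametrizes the affine hull and \<open>h\<close> reads off
    coordinates; they are mutually inverse between \<open>Rn n\<close> and the affine hull.\<close>
  define f where "f = (\<lambda>y. p + lincomb n c y)"
  define h where "h = (\<lambda>z. rvec_of n (\<lambda>i. c i \<bullet> (z - p)))"
  have f_hull: "f y \<in> affine hull M" for y
    unfolding f_def lincomb_def
    by (rule affine_add_sum) (use p pc in \<open>auto simp: affine_affine_hull hull_inc\<close>)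
  have fh: "f (h z) = z" if "z \<in> affine hull M" for z
    using expand[OF that] by (simp add: f_def h_def lincomb_rvec_of)
  have hf: "h (f y) = y" if "y \<in> Rn n" for y
  proof (rule Rn_eqI[OF _ that])
    show "h (f y) \<in> Rn n" by (simp add: h_def)
    fix i assume i: "i < n"
    have "c i \<bullet> lincomb n c y = (\<Sum>j<n. if j = i then Poly_Mapping.lookup y j else 0)"
      unfolding lincomb_def inner_sum_right by (intro sum.cong) (auto simp: cc i)
    then show "Poly_Mapping.lookup (h (f y)) i = Poly_Mapping.lookup y i"
      using i by (simp add: h_def f_def lookup_rvec_of)
  qed
  have hRn: "h z \<in> Rn n" for z by (simp add: h_def)
  define Q where "Q = {x \<in> Rn n. f x \<in> M}"
  have "affine_map_on (Rn n) f"
  proof -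
    have lin: "linear (lincomb n c)" by (rule bounded_linear.linear[OF bounded_linear_lincomb])
    have p: "(1 - t) *\<^sub>R p + t *\<^sub>R p = p" for t by (simp flip: scaleR_left_distrib)
    have "f ((1 - t) *\<^sub>R x + t *\<^sub>R y) = (1 - t) *\<^sub>R f x + t *\<^sub>R f y" for x y t
      using p[of t] unfolding f_def linear_add[OF lin] linear_scale[OF lin] scaleR_add_right
      by (metis add.assoc add.left_commute)
    then show ?thesis by (simp add: affine_map_on_def)
  qed
  moreover have "inj_on f (Rn n)" using hf by (rule inj_on_inverseI)
  moreover have "f ` Rn n = affine hull M"
    using f_hull fh hRn by (metis image_subset_iff rev_image_eqI subsetI subset_antisym)
  moreover have "full_polytope n Q"
  proof (rule full_polytope_affine_image[OF M])
    let ?H = "\<lambda>z. rvec_of n (\<lambda>i. c i \<bullet> z)"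
    show "bounded_linear ?H"
      by (intro bounded_linear_rvec_of bounded_linear_inner_right)
    have h: "(\<lambda>x. h 0 + ?H x) = h"
      by (auto simp: h_def lookup_add lookup_rvec_of inner_diff_right intro!: ext poly_mapping_eqI)
    show "Q \<subseteq> Rn n" by (auto simp: Q_def)
    show "Q = (\<lambda>x. h 0 + ?H x) ` M"
      unfolding h
    proof (intro equalityI subsetI)
      fix x assume "x \<in> Q"
      then show "x \<in> h ` M" using hf by (auto simp: Q_def intro!: rev_image_eqI[of "f x"])
    next
      fix x assume "x \<in> h ` M"
      then show "x \<in> Q" using fh hull_inc[of _ M affine] by (auto simp: Q_def h_def)
    qed
    show "Rn n \<subseteq> (\<lambda>x. h 0 + ?H x) ` (affine hull M)"
      unfolding h using hf f_hull by (metis image_eqI subsetI)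
  qed
  moreover have "\<exists>U V \<phi>. x \<in> U \<and> openin (top_of_set Q) U \<and> openin (top_of_set (orthant n)) V \<and>
      smooth_diffeo n U V \<phi>" if x: "x \<in> Q" for x
  proof -
    obtain a b where "\<And>F x. F facet_of M \<Longrightarrow> x \<in> M \<Longrightarrow> a F \<bullet> x \<le> b F"
      "\<And>F. F facet_of M \<Longrightarrow> F = M \<inter> {x. a F \<bullet> x = b F}"
      using facet_functionals[OF M(1)] by metis
    then interpret P: polytope_facets M a b
      by (intro polytope_facets.intro M)
    have "f x \<in> M" using x by (simp add: Q_def)
    then obtain m where m: "{m} face_of M" and mF: "\<And>F. F facet_of M \<Longrightarrow> f x \<in> F \<Longrightarrow> m \<in> F"
      using exists_vertex_in_all_facets_through[OF M(1)] by blast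
    have mM: "m \<in> M" using face_of_imp_subset[OF m] by simp
    have "card {F. F facet_of M \<and> m \<in> F} = n" using simple[OF m] dim by simp
    then obtain F g where F: "bij_betw F {..<n} {F. F facet_of M \<and> m \<in> F}"
      and mg: "\<And>i. i < n \<Longrightarrow> m + g i \<in> affine hull M"
      and ag: "\<And>i j. i < n \<Longrightarrow> j < n \<Longrightarrow> a (F j) \<bullet> g i = (if i = j then -1 else 0)"
      and zg: "\<And>z. z \<in> affine hull M \<Longrightarrow> z = m + (\<Sum>i<n. (b (F i) - a (F i) \<bullet> z) *\<^sub>R g i)"
      using P.simple_vertex_frame[OF m _ dim] by blast
    have Ff: "F i facet_of M" "m \<in> F i" if "i < n" for i
      using bij_betwE[OF F] that by auto
    \<comment> \<open>The chart at \<open>m\<close> forgets the facets that miss \<open>m\<close>;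
      keeping them strictly inactive defines both \<open>U\<close> and \<open>V\<close>.\<close>
    define K where "K = {G. G facet_of M \<and> m \<notin> G}"
    have finK: "finite K" unfolding K_def by (rule finite_subset[OF _ P.finite_facets]) auto
    \<comment> \<open>\<open>\<phi>\<close> takes the slacks at \<open>m\<close> as coordinates,
      \<open>e\<close> recovers the point of the affine hull from them, and \<open>\<psi>\<close>
      transports it back to \<open>Rn n\<close>.\<close>
    define e where "e = (\<lambda>y. m + lincomb n g y)"
    define \<phi> where "\<phi> = (\<lambda>x. rvec_of n (\<lambda>i. b (F i) - a (F i) \<bullet> f x))"
    define \<psi> where "\<psi> = (\<lambda>y. h (e y))"
    define U where "U = {x \<in> Q. \<forall>G\<in>K. a G \<bullet> f x < b G}"
    define V where "V = {y \<in> orthant n. \<forall>G\<in>K. a G \<bullet> e y < b G}"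
    have e_hull: "e y \<in> affine hull M" for y
      unfolding e_def lincomb_def
      by (rule affine_add_sum) (use mM mg in \<open>auto simp: affine_affine_hull hull_inc\<close>)
    have a_e: "b (F i) - a (F i) \<bullet> e y = Poly_Mapping.lookup y i" if i: "i < n" for i y
    proof -
      have "a (F i) \<bullet> lincomb n g y = (\<Sum>j<n. if j = i then - Poly_Mapping.lookup y j else 0)"
        unfolding lincomb_def inner_sum_right by (intro sum.cong) (auto simp: ag i)
      moreover have "a (F i) \<bullet> m = b (F i)" using Ff[OF i] by (simp add: P.mem_facet_iff)
      ultimately show ?thesis using i by (simp add: e_def inner_add_right)
    qed
    have e\<phi>: "e (\<phi> y) = f y" for y
      using zg[OF f_hull[of y]] by (simp add: e_def \<phi>_def lincomb_rvec_of)
    have f\<psi>: "f (\<psi> y) = e y" for y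
      by (simp add: \<psi>_def fh[OF e_hull])
    have \<psi>\<phi>: "\<psi> (\<phi> y) = y" if "y \<in> Rn n" for y
      by (simp add: \<psi>_def e\<phi> hf[OF that])
    have \<phi>\<psi>: "\<phi> (\<psi> y) = y" if "y \<in> Rn n" for y
      by (rule Rn_eqI[OF _ that]) (simp_all add: \<phi>_def f\<psi> lookup_rvec_of a_e)
    have \<phi>UV: "\<phi> y \<in> V" if y: "y \<in> U" for y
    proof -
      have "f y \<in> M" using y by (simp add: U_def Q_def)
      then have "\<phi> y \<in> orthant n"
        using P.facet_le Ff by (auto simp: orthant_def \<phi>_def lookup_rvec_of)
      then show ?thesis using y by (simp add: U_def V_def e\<phi>)
    qed
    \<comment> \<open>The inequalities of facets through \<open>m\<close> are the sign conditions of
      the orthant, the remaining ones are built into \<open>V\<close>; together they characterize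
      \<open>M\<close> in its affine hull.\<close>
    have \<psi>VU: "\<psi> y \<in> U" if y: "y \<in> V" for y
    proof -
      have "a G \<bullet> e y \<le> b G" if G: "G facet_of M" for G
      proof (cases "m \<in> G")
        case True
        then have "G \<in> F ` {..<n}" using F G by (simp add: bij_betw_def)
        then obtain i where "i < n" "G = F i" by blast
        moreover have "0 \<le> Poly_Mapping.lookup y i" if "i < n"
          using y that by (simp add: V_def orthant_def)
        ultimately show ?thesis using a_e[of i y] by simp
      next
        case False
        then show ?thesis using y G by (simp add: V_def K_def less_imp_le)
      qed
      then have "e y \<in> M" using e_hull by (simp add: P.mem_iff_facets)
      then show ?thesis using y hRn by (simp add: U_def V_def Q_def f\<psi>) (simp add: \<psi>_def)
    qed
    have VRn: "y \<in> Rn n" if "y \<in> V" for y using that by (simp add: V_def orthant_def)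
    have URn: "y \<in> Rn n" if "y \<in> U" for y using that by (simp add: U_def Q_def)
    \<comment> \<open>By its choice \<open>m\<close> lies on every facet through \<open>f x\<close>,
      so a facet missing \<open>m\<close> also misses \<open>f x\<close>.\<close>
    have "x \<in> U"
    proof -
      have "a G \<bullet> f x < b G" if G: "G \<in> K" for G
      proof -
        have "G facet_of M" "f x \<notin> G" using G mF by (auto simp: K_def)
        then show ?thesis
          using P.facet_le[of G "f x"] P.mem_facet_iff[of G "f x"] \<open>f x \<in> M\<close> by fastforce
      qed
      then show ?thesis using x by (simp add: U_def)
    qed
    moreover have "openin (top_of_set Q) U"
      unfolding U_def f_def inner_add_right
      by (intro openin_strict_constraints finK continuous_on_add continuous_on_const
          linear_continuous_on bounded_linear_inner_lincomb)
    moreover have "openin (top_of_set (orthant n)) V"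
      unfolding V_def e_def inner_add_right
      by (intro openin_strict_constraints finK continuous_on_add continuous_on_const
          linear_continuous_on bounded_linear_inner_lincomb)
    moreover have "smooth_diffeo n U V \<phi>"
    proof -
      have inj: "inj_on \<phi> U" using \<psi>\<phi> URn by (metis inj_on_inverseI)
      have "\<phi> ` U = V"
      proof (intro equalityI subsetI)
        fix y assume "y \<in> V"
        then show "y \<in> \<phi> ` U" using \<phi>\<psi> \<psi>VU VRn by (metis image_eqI)
      qed (use \<phi>UV in blast)
      moreover have "smooth_map n n U \<phi>"
      proof (rule smooth_map_affine)
        let ?L = "\<lambda>x. rvec_of n (\<lambda>i. - (a (F i) \<bullet> lincomb n c x))"
        show "bounded_linear ?L"
          by (intro bounded_linear_rvec_of bounded_linear_minus bounded_linear_inner_lincomb)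
        show "\<phi> y = rvec_of n (\<lambda>i. b (F i) - a (F i) \<bullet> p) + ?L y" for y
          by (rule poly_mapping_eqI) (simp add: \<phi>_def f_def lookup_add lookup_rvec_of inner_add_right)
      qed (auto simp: \<phi>_def)
      moreover have "smooth_map n n V (inv_into U \<phi>)"
      proof (rule smooth_map_affine)
        let ?L = "\<lambda>y. rvec_of n (\<lambda>i. c i \<bullet> lincomb n g y)"
        have inv: "inv_into U \<phi> y = \<psi> y" if "y \<in> V" for y
          by (rule inv_into_f_eq[OF inj \<psi>VU[OF that] \<phi>\<psi>[OF VRn[OF that]]])
        show "bounded_linear ?L"
          by (intro bounded_linear_rvec_of bounded_linear_inner_lincomb)
        show "inv_into U \<phi> y = h m + ?L y" if "y \<in> V" for y
          unfolding inv[OF that]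
          by (rule poly_mapping_eqI)
            (simp add: \<psi>_def e_def h_def lookup_add lookup_rvec_of inner_add_right inner_diff_right)
        show "inv_into U \<phi> \<in> V \<rightarrow> Rn n"
          using inv by (simp add: \<psi>_def h_def)
      qed simp
      ultimately show ?thesis
        using inj by (simp add: smooth_diffeo_def bij_betw_def)
    qed
    ultimately show ?thesis by blast
  qed
  ultimately have "affine_map_on (Rn n) f \<and> inj_on f (Rn n) \<and> f ` Rn n = affine hull M \<and>
      cube_like_Rn n {x \<in> Rn n. f x \<in> M}"
    unfolding cube_like_Rn_def Q_def[symmetric] by meson
  then show ?thesis
    unfolding cube_like_def using M dim by blast
qed

theorem proposition4p10:
  fixes M :: "'a::euclidean_space set"
  assumes "polytope M" and "M \<noteq> {}"
  shows "simple_polytope M \<longleftrightarrow> cube_like M"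
  using simple_imp_cube_like cube_like_imp_simple by blast

end
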